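(* Let $$\kappa_2=\frac{4\log\frac{5+\sqrt{29}}{2}-5\log(2+\sqrt5)}{\log\frac{5+\sqrt{29}}{2}-\log(2+\sqrt5)-\log\sqrt2}.$$ (i) Let $x\in(0,1)$ be irrational and suppose there exists a constant $C$ such that for all natural $t$ one has $$S_x(t)\ge\kappa_2t-C.$$ Then $?'(x)$ exists and $?'(x)=0$. (ii) Let $\psi(t)$ be an increasing function with $\lim_{t\to+\infty}\psi(t)=+\infty$. Then there exists an irrational number $x\in(0,1)$ such that $?'(x)$ does not exist and for every natural $t$ one has $$S_x(t)\ge\kappa_2t-\psi(t).$$
   Context: The Minkowski question mark function $?:[0,1]\to[0,1]$ is the continuous increasing function defined by $?(0)=0$, $?(1)=1$, by $?\left(\frac{p+p'}{q+q'}\right)=\frac12\left(?\left(\frac pq\right)+?\left(\frac{p'}{q'}\right)\right)$ for consecutive Farey fractions $\frac pq,\frac{p'}{q'}$, and extended by continuity to irrationals. Equivalently, for irrational $x=[0;a_1,a_2,\dots]$, $?(x)=\frac1{2^{a_1-1}}-\frac1{2^{a_1+a_2-1}}+\dots+\frac{(-1)^{n+1}}{2^{a_1+\dots+a_n-1}}+\cdots$. The derivative $?'(x)$ is understood as the limit of $\frac{?(x+\delta)-?(x)}{\delta}$ as $\delta\to0$ (two-sided), and the value $+\infty$ is allowed (so "$?'(x)$ exists" means that the limit exists as a finite number or equals $+\infty$). For irrational $x\in(0,1)$ with regular continued fraction expansion $x=[0;a_1,a_2,\dots]$ (natural partial quotients), $S_x(t)=a_1+a_2+\dots+a_t$. Numerically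 $\kappa_2\approx4.401$. *)

theory Defs
  imports "HOL-Analysis.Analysis"
begin

definition farey :: "nat \<Rightarrow> real set" where
  "farey n = {real p / real q | p q. 1 \<le> q \<and> q \<le> n \<and> p \<le> q}"

definition consecutive_farey :: "real \<Rightarrow> real \<Rightarrow> bool" where
  "consecutive_farey a b \<longleftrightarrow>
     (\<exists>n. a \<in> farey n \<and> b \<in> farey n \<and> a < b \<and> \<not> (\<exists>c\<in>farey n. a < c \<and> c < b))"

(* The coprimality conditions put both fractions in lowest terms, without which
   the mediant would not be determined by the two real numbers. *)
definition is_question_mark :: "(real \<Rightarrow> real) \<Rightarrow> bool" where
  "is_question_mark f \<longleftrightarrow>
     f \<in> {0..1} \<rightarrow>\<^sub>E {0..1} \<and> continuous_on {0..1} f \<and> mono_on {0..1} f \<and>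
     f 0 = 0 \<and> f 1 = 1 \<and>
     (\<forall>p q p' q' :: nat. 0 < q \<and> 0 < q' \<and> coprime p q \<and> coprime p' q' \<and>
        consecutive_farey (real p / real q) (real p' / real q') \<longrightarrow>
        f (real (p + p') / real (q + q')) = (f (real p / real q) + f (real p' / real q')) / 2)"

(* The description is proper: see question_mark_ex1 below. *)
definition question_mark :: "real \<Rightarrow> real" where
  "question_mark = (THE f. is_question_mark f)"

(* Two-sided derivative as a limit in the extended reals, so that the value
   \<infinity> is allowed. *)
definition has_ext_derivative :: "(real \<Rightarrow> real) \<Rightarrow> ereal \<Rightarrow> real \<Rightarrow> bool" where
  "has_ext_derivative f L x \<longleftrightarrow>
     ((\<lambda>\<delta>. ereal ((f (x + \<delta>) - f x) / \<delta>)) \<longlongrightarrow> L) (at 0)"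

definition ext_derivative_exists :: "(real \<Rightarrow> real) \<Rightarrow> real \<Rightarrow> bool" where
  "ext_derivative_exists f x \<longleftrightarrow> (\<exists>L. L \<noteq> -\<infinity> \<and> has_ext_derivative f L x)"

(* Iterates of the Gauss map; cf_rem x n = [0; a_(n+1), a_(n+2), ...]. *)
fun cf_rem :: "real \<Rightarrow> nat \<Rightarrow> real" where
  "cf_rem x 0 = x"
| "cf_rem x (Suc n) = frac (1 / cf_rem x n)"

(* The partial quotient a_n of x = [0; a_1, a_2, ...], for n \<ge> 1 and irrational x in (0,1). *)
definition partial_quotient :: "real \<Rightarrow> nat \<Rightarrow> nat" where
  "partial_quotient x n = nat \<lfloor>1 / cf_rem x (n - 1)\<rfloor>"

definition pq_sum :: "real \<Rightarrow> nat \<Rightarrow> nat" where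
  "pq_sum x t = (\<Sum>i=1..t. partial_quotient x i)"

definition kappa2 :: real where
  "kappa2 = (4 * ln ((5 + sqrt 29) / 2) - 5 * ln (2 + sqrt 5)) /
            (ln ((5 + sqrt 29) / 2) - ln (2 + sqrt 5) - ln (sqrt 2))"

lemma has_ext_derivative_real:
  "has_ext_derivative f (ereal c) x \<longleftrightarrow> (f has_real_derivative c) (at x)"
  unfolding has_ext_derivative_def DERIV_def by simp

lemma cf_rem_irrational:
  assumes "x \<notin> \<rat>" "0 < x" "x < 1"
  shows "cf_rem x n \<notin> \<rat> \<and> 0 < cf_rem x n \<and> cf_rem x n < 1"
proof (induction n)
  case 0
  then show ?case using assms by simp
next
  case (Suc n)
  let ?y = "1 / cf_rem x n"
  have y: "?y \<notin> \<rat>"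
  proof
    assume "?y \<in> \<rat>"
    from Rats_divide[OF Rats_1 this] show False using Suc by simp
  qed
  have "frac ?y \<notin> \<rat>"
  proof
    assume "frac ?y \<in> \<rat>"
    then have "frac ?y + of_int \<lfloor>?y\<rfloor> \<in> \<rat>" by (intro Rats_add) auto
    then show False using y by (simp add: frac_def)
  qed
  moreover from this have "frac ?y \<noteq> 0" by (metis Rats_0)
  ultimately show ?case using frac_ge_0[of ?y] frac_lt_1[of ?y] by (simp add: less_le)
qed

lemma cf_rem_step:
  assumes "x \<notin> \<rat>" "0 < x" "x < 1"
  shows "partial_quotient x (Suc n) \<ge> 1"
    and "cf_rem x n = 1 / (real (partial_quotient x (Suc n)) + cf_rem x (Suc n))"
proof -
  let ?y = "1 / cf_rem x n"
  have y: "?y > 1" and nz: "cf_rem x n > 0" using cf_rem_irrational[OF assms, of n] by auto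
  then have fl: "\<lfloor>?y\<rfloor> \<ge> 1" by linarith
  then show "partial_quotient x (Suc n) \<ge> 1" unfolding partial_quotient_def by simp linarith
  have "real (partial_quotient x (Suc n)) + cf_rem x (Suc n) = ?y"
    using of_nat_nat[of "\<lfloor>?y\<rfloor>"] fl
    by (simp only: partial_quotient_def frac_def diff_Suc_1 cf_rem.simps)
  then show "cf_rem x n = 1 / (real (partial_quotient x (Suc n)) + cf_rem x (Suc n))"
    using nz by simp
qed

lemma frac_less_iff:
  assumes "0 < q" "0 < (s::nat)"
  shows "real p / real q < real r / real s \<longleftrightarrow> int p * int s < int r * int q"
proof -
  have "real p / real q < real r / real s \<longleftrightarrow> real p * real s < real r * real q"
    using assms by (simp add: field_simps)
  also have "\<dots> \<longleftrightarrow> int p * int s < int r * int q"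
    by (metis of_nat_less_iff of_nat_mult)
  finally show ?thesis .
qed

lemma consecutive_fareyI:
  assumes "0 < q" "0 < q'" "int p' * int q = int p * int q' + 1" "p' \<le> q'"
  shows "consecutive_farey (real p / real q) (real p' / real q')"
proof -
  let ?n = "max q q'"
  have lt: "real p / real q < real p' / real q'"
    using assms by (simp add: frac_less_iff)
  have "real p' / real q' \<le> 1" using assms by simp
  with lt have "real p / real q < 1" by linarith
  then have pq: "p \<le> q" using assms by simp
  have no: "\<not> (\<exists>c\<in>farey ?n. real p / real q < c \<and> c < real p' / real q')"
  proof
    assume "\<exists>c\<in>farey ?n. real p / real q < c \<and> c < real p' / real q'"
    then obtain r s :: nat where rs: "1 \<le> s" "s \<le> ?n"
      "real p / real q < real r / real s" "real r / real s < real p' / real q'"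
      unfolding farey_def by auto
    have 1: "int r * int q - int p * int s \<ge> 1" "int p' * int s - int r * int q' \<ge> 1"
      using rs assms(1,2) by (auto simp: frac_less_iff)
    have "int s = int s * (int p' * int q - int p * int q')" using assms(3) by simp
    also have "\<dots> = int q * (int p' * int s - int r * int q') + int q' * (int r * int q - int p * int s)"
      by (simp add: algebra_simps)
    also have "\<dots> \<ge> int q * 1 + int q' * 1"
      using 1 by (intro add_mono mult_left_mono) auto
    finally show False using rs(2) assms(1,2) by auto
  qed
  have "real p / real q \<in> farey ?n" "real p' / real q' \<in> farey ?n"
    using assms pq unfolding farey_def by (auto simp: Suc_le_eq) (metis max.cobounded1 max.cobounded2)+
  then show ?thesis unfolding consecutive_farey_def using lt no by blast
qed

lemma lowest_terms_dvd:
  assumes "0 < q" "0 < s" "coprime p q" "real p / real q = real r / real s"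
  shows "q dvd s"
proof -
  have "real p * real s = real r * real q" using assms by (simp add: field_simps)
  then have "p * s = r * q" by (metis of_nat_eq_iff of_nat_mult)
  then have "q dvd p * s" by simp
  then show ?thesis using assms(3) by (simp add: coprime_commute coprime_dvd_mult_right_iff)
qed

lemma lowest_terms_le:
  assumes "0 < q" "coprime p q" "real p / real q \<in> farey n"
  shows "q \<le> n" "p \<le> q"
proof -
  obtain r s :: nat where rs: "1 \<le> s" "s \<le> n" "r \<le> s" "real p / real q = real r / real s"
    using assms unfolding farey_def by auto
  then have "q dvd s" using lowest_terms_dvd assms by auto
  then show "q \<le> n" using rs by (meson dvd_imp_le le_trans less_le_trans zero_less_one)
  have "real p / real q \<le> 1" using rs by simp
  then show "p \<le> q" using assms by simp
qed

lemma consecutive_fareyD: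
  assumes "0 < q" "0 < q'" "coprime p q" "coprime p' q'"
    and c: "consecutive_farey (real p / real q) (real p' / real q')"
  shows "int p' * int q = int p * int q' + 1" "p' \<le> q'"
proof -
  obtain n where n: "real p / real q \<in> farey n" "real p' / real q' \<in> farey n"
     and lt: "real p / real q < real p' / real q'"
     and no: "\<And>c. c \<in> farey n \<Longrightarrow> \<not> (real p / real q < c \<and> c < real p' / real q')"
    using c unfolding consecutive_farey_def by auto
  have qn: "q \<le> n" "q' \<le> n" using lowest_terms_le n assms by blast+
  show p'q': "p' \<le> q'" using lowest_terms_le n assms by blast
  have "real p' / real q' \<le> 1" using p'q' assms by simp
  with lt have "real p / real q < 1" by linarith
  then have pq: "p < q" using assms by simp
  have D: "int p' * int q - int p * int q' \<ge> 1" using lt assms by (simp add: frac_less_iff)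
  from assms(3) have "coprime (int p) (int q)" by simp
  then obtain u0 v0 where "u0 * int p + v0 * int q = 1"
    using bezout_int[of "int p" "int q"] by auto
  then have b0: "v0 * int q - int p * (- u0) = 1" by (simp add: algebra_simps)
  define k where "k = (int n + u0) div int q"
  define v where "v = - u0 + k * int q"
  define u where "u = v0 + k * int p"
  have uv: "u * int q - int p * v = 1" using b0 by (simp add: u_def v_def algebra_simps)
  have vv: "v = int n - (int n + u0) mod int q"
    unfolding v_def k_def by (simp add: minus_mod_eq_div_mult[symmetric])
  have v: "v \<le> int n" "int n - int q < v"
    unfolding vv using assms(1) by auto
  have v1: "v \<ge> 1" using v qn by linarith
  have "u * int q > 0" using uv v1 by (smt (verit) mult_nonneg_nonneg of_nat_0_le_iff)
  then have u1: "u \<ge> 0" using assms(1) by (simp add: zero_less_mult_iff)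
  have "u * int q \<le> 1 + (int q - 1) * v" using uv pq v1
    by (smt (verit, best) mult_right_mono zless_nat_conj of_nat_less_iff)
  also have "\<dots> \<le> v * int q" using v1 by (simp add: algebra_simps)
  finally have "u \<le> v" using assms(1) by simp
  define r s where "r = nat u" and "s = nat v"
  have rs: "u = int r" "v = int s" "1 \<le> s" "s \<le> n" "r \<le> s"
    using v1 v u1 \<open>u \<le> v\<close> by (auto simp: r_def s_def)
  have "real r / real s \<in> farey n" using rs unfolding farey_def by auto
  moreover have "real p / real q < real r / real s"
    using uv rs assms by (simp add: frac_less_iff)
  ultimately have ge: "real p' / real q' \<le> real r / real s" using no by force
  show "int p' * int q = int p * int q' + 1"
  proof (cases "real p' / real q' = real r / real s")
    case True
    have "real p' * real s = real r * real q'" using True rs assms by (simp add: field_simps)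
    then have e: "int p' * int s = int r * int q'" by (metis of_nat_eq_iff of_nat_mult)
    have "int q' dvd int s" using lowest_terms_dvd[OF _ _ _ True] assms rs by auto
    then obtain m where m: "int s = int q' * m" by (auto simp: dvd_def)
    have "int r = int p' * m" using e m assms by simp
    then have "m * (int p' * int q - int p * int q') = 1" using uv m rs by (simp add: algebra_simps)
    then show ?thesis using D by (simp add: zmult_eq_1_iff)
  next
    case False
    then have "real p' / real q' < real r / real s" using ge by simp
    then have E: "u * int q' - int p' * v \<ge> 1" using rs assms by (simp add: frac_less_iff)
    have "int q' = int q' * (u * int q - int p * v)" using uv by simp
    also have "\<dots> = int q * (u * int q' - int p' * v) + v * (int p' * int q - int p * int q')"
      by (simp add: algebra_simps)
    also have "\<dots> \<ge> int q * 1 + v * 1"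
      using D E v1 by (intro add_mono mult_left_mono) auto
    finally show ?thesis using v qn by simp
  qed
qed

lemma det_coprime:
  assumes "int p' * int q = int p * int q' + 1"
  shows "coprime p q" "coprime p' q'"
proof -
  have "c dvd 1" if "c dvd p" "c dvd q" for c
  proof -
    have "int c dvd int p' * int q - int p * int q'" using that by (intro dvd_diff) auto
    then show ?thesis using assms by simp
  qed
  then show "coprime p q" by (intro coprimeI) auto
  have "c dvd 1" if "c dvd p'" "c dvd q'" for c
  proof -
    have "int c dvd int p' * int q - int p * int q'" using that by (intro dvd_diff) auto
    then show ?thesis using assms by simp
  qed
  then show "coprime p' q'" by (intro coprimeI) auto
qed

lemma is_question_mark_mediant:
  assumes "is_question_mark f" "0 < q" "0 < q'" "int p' * int q = int p * int q' + 1" "p' \<le> q'"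
  shows "f (real (p + p') / real (q + q')) = (f (real p / real q) + f (real p' / real q')) / 2"
  using assms det_coprime[OF assms(4)] consecutive_fareyI[OF assms(2-5)]
  unfolding is_question_mark_def by blast

lemma is_question_mark_eq_rat:
  assumes f: "is_question_mark f" and g: "is_question_mark g"
    and "0 < q" "0 < q'" "int p' * int q = int p * int q' + 1" "p' \<le> q'" "0 < s"
    and "int p * int s \<le> int r * int q" "int r * int q' \<le> int p' * int s"
    and "f (real p / real q) = g (real p / real q)" "f (real p' / real q') = g (real p' / real q')"
  shows "f (real r / real s) = g (real r / real s)"
  using assms(3-)
proof (induction "nat ((int r * int q - int p * int s) + (int p' * int s - int r * int q'))"
    arbitrary: p q p' q' rule: less_induct)
  case less
  note h = less.prems
  have eqI: "real r / real s = real a / real b"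
    if "int r * int b = int a * int s" "0 < b" for a b
  proof -
    have "real r * real b = real a * real s" using that by (metis of_nat_eq_iff of_nat_mult)
    then show ?thesis using that \<open>0 < s\<close> by (simp add: field_simps)
  qed
  let ?m = "p + p'" and ?n = "q + q'"
  have fm: "f (real ?m / real ?n) = g (real ?m / real ?n)"
    using is_question_mark_mediant[OF f h(1-4)] is_question_mark_mediant[OF g h(1-4)] h(8,9) by simp
  have "p \<le> q"
  proof (rule ccontr)
    assume "\<not> p \<le> q"
    then have "int q * int q' \<le> int p * int q'" by (intro mult_right_mono) auto
    moreover have "int p' * int q \<le> int q' * int q" using h by (intro mult_right_mono) auto
    ultimately show False using h(3) by (simp add: mult.commute)
  qed
  consider "int r * int q = int p * int s" | "int r * int q' = int p' * int s"
    | "int r * int ?n = int ?m * int s"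
    | "int p * int s < int r * int q" "int r * int q' < int p' * int s" "int r * int ?n < int ?m * int s"
    | "int p * int s < int r * int q" "int r * int q' < int p' * int s" "int r * int ?n > int ?m * int s"
    using h by linarith
  then show ?case
  proof cases
    case 1
    then show ?thesis using eqI h by metis
  next
    case 2
    then show ?thesis using eqI h by metis
  next
    case 3
    then show ?thesis using eqI[OF 3] fm h(1) by simp
  next
    case 4
    show ?thesis
      using 4 h \<open>p \<le> q\<close> fm
      by (intro less.hyps[of q p ?m ?n]) (auto simp: algebra_simps)
  next
    case 5
    show ?thesis
      using 5 h \<open>p \<le> q\<close> fm
      by (intro less.hyps[of ?n ?m p' q']) (auto simp: algebra_simps)
  qed
qed

lemma is_question_mark_unique:
  assumes f: "is_question_mark f" and g: "is_question_mark g"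
  shows "f = g"
proof -
  have rat: "f x = g x" if x: "x \<in> {0<..<1} \<inter> \<rat>" for x
  proof -
    obtain r s :: nat where rs: "s \<noteq> 0" "\<bar>x\<bar> = real r / real s"
      using x Rats_abs_nat_div_natE by blast
    then have xr: "x = real r / real s" using x by simp
    then have "real r / real s < 1" using x by simp
    then have "r < s" using rs(1) by simp
    then show ?thesis
      using is_question_mark_eq_rat[OF f g, of 1 1 1 0 s r] f g
      unfolding xr is_question_mark_def by simp
  qed
  have cl: "closure ({0<..<1} \<inter> \<rat>) = {0..1::real}"
    using closure_open_Int_superset[of "{0<..<1::real}" \<rat>] by (simp add: Rats_closure_real)
  have "f x - g x = 0" if "x \<in> {0..1}" for x
  proof (rule continuous_constant_on_closure[where f = "\<lambda>x. f x - g x" and S = "{0<..<1} \<inter> \<rat>"])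
    show "continuous_on (closure ({0<..<1} \<inter> \<rat>)) (\<lambda>x. f x - g x)"
      unfolding cl using f g by (auto simp: is_question_mark_def intro!: continuous_intros)
  qed (use rat that cl in auto)
  moreover have "f \<in> extensional {0..1}" "g \<in> extensional {0..1}"
    using f g by (auto simp: is_question_mark_def PiE_def)
  ultimately show ?thesis by (intro extensionalityI) auto
qed

(* Existence: question_mark is the fixed point of this contraction. *)
definition qm_step :: "(real \<Rightarrow> real) \<Rightarrow> real \<Rightarrow> real" where
  "qm_step f x = (if x \<le> 1 / 2 then f (x / (1 - x)) / 2 else 1 - f ((1 - x) / x) / 2)"

definition qm_good :: "(real \<Rightarrow> real) \<Rightarrow> bool" where
  "qm_good f \<longleftrightarrow> continuous_on {0..1} f \<and> mono_on {0..1} f \<and> f 0 = 0 \<and> f 1 = 1"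

lemma qm_good_bounds:
  assumes "qm_good f" "x \<in> {0..1}"
  shows "0 \<le> f x" "f x \<le> 1"
  using assms mono_onD[of "{0..1}" f 0 x] mono_onD[of "{0..1}" f x 1] by (auto simp: qm_good_def)

lemma qm_good_step:
  assumes f: "qm_good f"
  shows "qm_good (qm_step f)"
proof -
  have c: "continuous_on {0..1} f" and m: "mono_on {0..1} f" and v: "f 0 = 0" "f 1 = 1"
    using f by (auto simp: qm_good_def)
  have "continuous_on ({0..1/2} \<union> {1/2..1})
          (\<lambda>x. if x \<le> 1 / 2 then f (x / (1 - x)) / 2 else 1 - f ((1 - x) / x) / 2)"
  proof (rule continuous_on_cases)
    show "continuous_on {0..1/2} (\<lambda>x. f (x / (1 - x)) / 2)"
      by (intro continuous_intros continuous_on_compose2[OF c]) (auto simp: field_simps)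
    show "continuous_on {1/2..1} (\<lambda>x. 1 - f ((1 - x) / x) / 2)"
      by (intro continuous_intros continuous_on_compose2[OF c]) (auto simp: field_simps)
    show "\<forall>x. x \<in> {0..1/2} \<and> \<not> x \<le> 1/2 \<or> x \<in> {1/2..1} \<and> x \<le> 1/2 \<longrightarrow>
             f (x / (1 - x)) / 2 = 1 - f ((1 - x) / x) / 2"
    proof (intro allI impI)
      fix x :: real assume "x \<in> {0..1/2} \<and> \<not> x \<le> 1/2 \<or> x \<in> {1/2..1} \<and> x \<le> 1/2"
      then have x: "x = 1/2" by auto
      have "x / (1 - x) = 1" "(1 - x) / x = 1" unfolding x by simp_all
      then show "f (x / (1 - x)) / 2 = 1 - f ((1 - x) / x) / 2" by (simp only: v)
    qed
  qed auto
  moreover have "{0..1/2} \<union> {1/2..1} = {0..1::real}" by auto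
  ultimately have 1: "continuous_on {0..1} (qm_step f)"
    unfolding qm_step_def[abs_def] by simp
  have 2: "mono_on {0..1} (qm_step f)"
  proof (rule mono_onI)
    fix x y :: real assume xy: "x \<in> {0..1}" "y \<in> {0..1}" "x \<le> y"
    consider "y \<le> 1/2" | "x \<le> 1/2" "y > 1/2" | "x > 1/2" using xy by linarith
    then show "qm_step f x \<le> qm_step f y"
    proof cases
      case 1
      then have "f (x / (1 - x)) \<le> f (y / (1 - y))"
        using xy by (intro mono_onD[OF m]) (auto simp: field_simps)
      then show ?thesis using 1 xy by (simp add: qm_step_def)
    next
      case 2
      have "f (x / (1 - x)) \<le> 1" "f ((1 - y) / y) \<le> 1"
        using 2 xy by (auto intro!: qm_good_bounds[OF f] simp: field_simps)
      then show ?thesis using 2 by (simp add: qm_step_def)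
    next
      case 3
      then have "f ((1 - y) / y) \<le> f ((1 - x) / x)"
        using xy by (intro mono_onD[OF m]) (auto simp: field_simps)
      then show ?thesis using 3 xy by (simp add: qm_step_def)
    qed
  qed
  show ?thesis using 1 2 v by (simp add: qm_good_def qm_step_def)
qed

lemma qm_step_dist:
  assumes "\<And>x. x \<in> {0..1} \<Longrightarrow> \<bar>f x - g x\<bar> \<le> c" "x \<in> {0..1}"
  shows "\<bar>qm_step f x - qm_step g x\<bar> \<le> c / 2"
proof (cases "x \<le> 1/2")
  case True
  then have "x / (1 - x) \<in> {0..1}" using assms(2) by (auto simp: field_simps)
  from assms(1)[OF this] show ?thesis using True unfolding qm_step_def by (simp only: if_True abs_le_iff) linarith
next
  case False
  then have "(1 - x) / x \<in> {0..1}" using assms(2) by (auto simp: field_simps)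
  from assms(1)[OF this] show ?thesis using False unfolding qm_step_def by (simp only: if_False abs_le_iff) linarith
qed

lemma qm_fixed_point_exists:
  "\<exists>g. qm_good g \<and> (\<forall>x\<in>{0..1}. qm_step g x = g x)"
proof -
  define F where "F n = (qm_step ^^ n) (\<lambda>x. x)" for n
  have FS: "F (Suc n) = qm_step (F n)" for n by (simp add: F_def)
  have good: "qm_good (F n)" for n
  proof (induction n)
    case 0
    then show ?case by (simp add: F_def qm_good_def mono_on_def)
  next
    case (Suc n)
    then show ?case by (simp add: FS qm_good_step)
  qed
  have bd: "\<bar>F (Suc n) x - F n x\<bar> \<le> (1/2) ^ n" if "x \<in> {0..1}" for n x
    using that
  proof (induction n arbitrary: x)
    case 0
    then show ?case
      using qm_good_bounds[OF good, of x 0] qm_good_bounds[OF good, of x "Suc 0"] by (simp add: abs_le_iff)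
  next
    case (Suc n)
    show ?case
      using qm_step_dist[of "F (Suc n)" "F n" "(1/2) ^ n", OF Suc.IH Suc.prems] by (simp add: FS)
  qed
  define g where "g x = x + (\<Sum>i. F (Suc i) x - F i x)" for x
  have ul: "uniform_limit {0..1} (\<lambda>n x. \<Sum>i<n. F (Suc i) x - F i x)
              (\<lambda>x. \<Sum>i. F (Suc i) x - F i x) sequentially"
    by (rule Weierstrass_m_test[where M = "\<lambda>n. (1/2) ^ n"]) (use bd in auto)
  have sum: "(\<Sum>i<n. F (Suc i) x - F i x) = F n x - x" for n x
    by (subst sum_lessThan_telescope) (simp add: F_def)
  have "continuous_on {0..1} (\<lambda>x. \<Sum>i. F (Suc i) x - F i x)"
    using good by (intro uniform_limit_theorem[OF _ ul])
      (auto simp: sum qm_good_def intro!: always_eventually continuous_intros)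
  then have c: "continuous_on {0..1} g"
    unfolding g_def by (intro continuous_intros)
  have lim: "(\<lambda>n. F n x) \<longlonglongrightarrow> g x" if "x \<in> {0..1}" for x
  proof -
    have "(\<lambda>n. x + (F n x - x)) \<longlonglongrightarrow> g x"
      unfolding g_def using tendsto_uniform_limitI[OF ul that] by (intro tendsto_intros) (simp add: sum)
    then show ?thesis by simp
  qed
  have m: "mono_on {0..1} g"
  proof (rule mono_onI)
    fix x y :: real assume xy: "x \<in> {0..1}" "y \<in> {0..1}" "x \<le> y"
    have "F n x \<le> F n y" for n using good[of n] xy by (auto simp: qm_good_def mono_on_def)
    then show "g x \<le> g y" using LIMSEQ_le[OF lim[OF xy(1)] lim[OF xy(2)]] by blast
  qed
  have "g 0 = 0" "g 1 = 1"
    using lim[of 0] lim[of 1] good by (auto simp: qm_good_def dest: LIMSEQ_unique[OF _ tendsto_const])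
  moreover have "qm_step g x = g x" if x: "x \<in> {0..1}" for x
  proof -
    have "(\<lambda>n. qm_step (F n) x) \<longlonglongrightarrow> qm_step g x"
    proof (cases "x \<le> 1/2")
      case True
      then have "x / (1 - x) \<in> {0..1}" using x by (auto simp: field_simps)
      then show ?thesis using True unfolding qm_step_def by (auto intro!: tendsto_intros lim)
    next
      case False
      then have "(1 - x) / x \<in> {0..1}" using x by (auto simp: field_simps)
      then show ?thesis using False unfolding qm_step_def by (auto intro!: tendsto_intros lim)
    qed
    moreover have "(\<lambda>n. qm_step (F n) x) \<longlonglongrightarrow> g x"
      using LIMSEQ_Suc[OF lim[OF x]] by (simp add: FS)
    ultimately show ?thesis by (rule LIMSEQ_unique)
  qed
  ultimately show ?thesis using c m unfolding qm_good_def by blast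
qed

lemma qm_fixed_point_mediant:
  assumes g: "qm_good g" and fp: "\<And>x. x \<in> {0..1} \<Longrightarrow> qm_step g x = g x"
    and "0 < q" "0 < q'" "int p' * int q = int p * int q' + 1" "p' \<le> q'"
  shows "g (real (p + p') / real (q + q')) = (g (real p / real q) + g (real p' / real q')) / 2"
  using assms(3-)
proof (induction "q + q'" arbitrary: p q p' q' rule: less_induct)
  case less
  note h = less.prems
  have lo: "g (real a / real b) = g (real a / real (b - a)) / 2" if "2 * a \<le> b" "0 < b" for a b
  proof -
    have "real a / real b \<le> 1/2" "real a / real b \<in> {0..1}" using that by (auto simp: field_simps)
    moreover have "real b * (1 - real a / real b) = real (b - a)"
      using that by (simp add: of_nat_diff right_diff_distrib)
    then have "(real a / real b) / (1 - real a / real b) = real a / real (b - a)"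
      by (metis divide_divide_eq_left)
    ultimately show ?thesis
      using fp[of "real a / real b"] unfolding qm_step_def by (simp only: if_True)
  qed
  have hi: "g (real a / real b) = 1 - g (real (b - a) / real a) / 2"
    if "2 * a \<ge> b" "0 < b" "a \<le> b" for a b
  proof (cases "2 * a = b")
    case True
    then show ?thesis using lo[of a b] that g by (auto simp: qm_good_def)
  next
    case False
    then have "2 * a > b" using that by simp
    then have "real a / real b > 1/2" "real a / real b \<in> {0..1}"
      using that by (auto simp: field_simps)
    moreover have "(1 - real a / real b) * real b = real (b - a)"
      using that by (simp add: of_nat_diff left_diff_distrib)
    then have "(1 - real a / real b) / (real a / real b) = real (b - a) / real a"
      by (metis divide_divide_eq_right)
    ultimately show ?thesis
      using fp[of "real a / real b"] unfolding qm_step_def by (simp only: not_le[symmetric] if_False)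
  qed
  have "0 \<le> int p * int q'" by simp
  then have "int p' * int q \<noteq> 0" using h(3) by linarith
  then have p': "0 < p'" by simp
  have pq: "p < q"
  proof (rule ccontr)
    assume "\<not> p < q"
    then have "int q * int q' \<le> int p * int q'" by (intro mult_right_mono) auto
    moreover have "int p' * int q \<le> int q' * int q" using h by (intro mult_right_mono) auto
    ultimately show False using h(3) by (simp add: mult.commute)
  qed
  consider "2 * p' \<le> q'" | "2 * p \<ge> q" | "2 * p < q" "2 * p' > q'" by linarith
  then show ?case
  proof cases
    case 1
    have "2 * p \<le> q"
    proof (rule ccontr)
      assume "\<not> 2 * p \<le> q"
      then have "int q * int q' \<le> (2 * int p) * int q'" by (intro mult_right_mono) auto
      moreover have "(2 * int p') * int q \<le> int q' * int q" using 1 by (intro mult_right_mono) auto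
      ultimately show False using h(3) mult.commute[of "int q" "int q'"] by linarith
    qed
    have *: "g (real (p + p') / real ((q - p) + (q' - p'))) =
        (g (real p / real (q - p)) + g (real p' / real (q' - p'))) / 2"
      using 1 h pq p' by (intro less.hyps) (auto simp: of_nat_diff algebra_simps)
    have e: "(q - p) + (q' - p') = (q + q') - (p + p')" using pq h by simp
    show ?thesis
      using * lo[of p q] lo[of p' q'] lo[of "p + p'" "q + q'"] 1 \<open>2 * p \<le> q\<close> h
      unfolding e by simp
  next
    case 2
    have "2 * p' \<ge> q'"
    proof (rule ccontr)
      assume "\<not> 2 * p' \<ge> q'"
      then have "(2 * int p') * int q \<le> int q' * int q" by (intro mult_right_mono) auto
      moreover have "int q * int q' \<le> (2 * int p) * int q'" using 2 by (intro mult_right_mono) auto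
      ultimately show False using h(3) mult.commute[of "int q" "int q'"] by linarith
    qed
    have *: "g (real ((q' - p') + (q - p)) / real (p' + p)) =
        (g (real (q' - p') / real p') + g (real (q - p) / real p)) / 2"
      using 2 h pq p' by (intro less.hyps) (auto simp: of_nat_diff algebra_simps)
    have e: "(q' - p') + (q - p) = (q + q') - (p + p')" "p' + p = p + p'" using pq h by auto
    have "g (real p / real q) = 1 - g (real (q - p) / real p) / 2"
      "g (real p' / real q') = 1 - g (real (q' - p') / real p') / 2"
      "g (real (p + p') / real (q + q')) =
         1 - g (real ((q + q') - (p + p')) / real (p + p')) / 2"
      using 2 \<open>2 * p' \<ge> q'\<close> h pq by (intro hi; simp)+
    then show ?thesis using *[unfolded e] by (simp only:) argo
  next
    case 3
    have "(int q' + 1) * int q \<le> (2 * int p') * int q" using 3 by (intro mult_right_mono) auto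
    moreover have "(2 * int p) * int q' \<le> (int q - 1) * int q'" using 3 by (intro mult_right_mono) auto
    ultimately have "int q + int q' \<le> 2" using h(3) by (simp add: algebra_simps)
    then have "q = 1" "q' = 1" using h by auto
    moreover have "p = 0" "p' = 1" using calculation 3 h by auto
    ultimately show ?thesis using lo[of 1 2] g by (simp add: qm_good_def)
  qed
qed

theorem question_mark_ex1: "\<exists>!f. is_question_mark f"
proof -
  obtain g where g: "qm_good g" and fp: "\<And>x. x \<in> {0..1} \<Longrightarrow> qm_step g x = g x"
    using qm_fixed_point_exists by blast
  define f where "f = restrict g {0..1}"
  have fg: "f x = g x" if "x \<in> {0..1}" for x using that by (simp add: f_def)
  have "is_question_mark f"
    unfolding is_question_mark_def
  proof (intro conjI allI impI)
    show "f \<in> {0..1} \<rightarrow>\<^sub>E {0..1}" using qm_good_bounds[OF g] by (auto simp: f_def)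
    show "continuous_on {0..1} f"
      using g continuous_on_cong[of "{0..1}" "{0..1}" f g] fg by (auto simp: qm_good_def)
    show "mono_on {0..1} f" using g by (auto simp: qm_good_def mono_on_def f_def)
    show "f 0 = 0" "f 1 = 1" using g by (auto simp: qm_good_def f_def)
    fix p q p' q' :: nat
    assume a: "0 < q \<and> 0 < q' \<and> coprime p q \<and> coprime p' q' \<and>
        consecutive_farey (real p / real q) (real p' / real q')"
    then have d: "int p' * int q = int p * int q' + 1" "p' \<le> q'"
      using consecutive_fareyD by blast+
    have "real p / real q < real p' / real q'" using a unfolding consecutive_farey_def by blast
    moreover have "real p' / real q' \<le> 1" using d a by simp
    ultimately have "real p / real q \<le> 1" by linarith
    then have "p \<le> q" using a by simp
    then show "f (real (p + p') / real (q + q')) = (f (real p / real q) + f (real p' / real q')) / 2"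
      using qm_fixed_point_mediant[OF g fp _ _ d] a d by (simp add: fg)
  qed
  then show ?thesis using is_question_mark_unique by blast
qed

lemma is_question_mark_question_mark: "is_question_mark question_mark"
  unfolding question_mark_def by (rule theI'[OF question_mark_ex1])

end

theory Submission
  imports Defs
begin

text \<open>
  Write \<open>q\<^sub>t\<close> for the denominators of the convergents of \<open>x\<close> and \<open>S\<^sub>t\<close> for the digit sums. On the cylinder
  of order \<open>t\<close> the function stretches lengths by a factor comparable to \<open>q\<^sub>t\<^sup>2 / 2 ^ S\<^sub>t\<close>. Hence the
  derivative is 0 if this quantity tends to 0, and it does not exist if the quantity tends to 0
  along one sequence of indices and to infinity along another.

  The denominators are controlled by the weights \<open>w\<^sub>n = \<mu> \<rho> ^ n\<close> that equal the spectral radii of the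
  digit matrices for \<open>n = 4\<close> and \<open>n = 5\<close>. For these weights the maximum of the two left eigenforms is
  a Lyapunov function: it never grows faster than \<open>w\<^sub>n\<close>, and it loses a fixed factor whenever a digit
  other than 4 and 5 occurs or, among digits 4 and 5, a 5 follows a 4. Since \<open>q\<^sub>t\<^sup>2 / 2 ^ S\<^sub>t\<close> is the square of
  \<open>q\<^sub>t\<close> over the product of the weights, times \<open>exp (- 2 \<beta> (S\<^sub>t - \<kappa>\<^sub>2 t))\<close> with \<open>\<beta> > 0\<close>, a
  lower bound on \<open>S\<^sub>t - \<kappa>\<^sub>2 t\<close> forces it to 0: the digits cannot be eventually 4, and if they are
  eventually 5 then \<open>S\<^sub>t - \<kappa>\<^sub>2 t\<close> tends to infinity. Conversely, long runs of 5 followed by long runs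
  of 4 lose only one bounded factor per run, so \<open>S\<^sub>t - \<kappa>\<^sub>2 t\<close> can be driven to \<open>-\<infinity>\<close> arbitrarily slowly
  and still outweigh these losses.
\<close>

section \<open>The question mark function near rational points\<close>

text \<open>\<open>question_mark\<close> is known only through its mediant property. The fixed point
  of \<open>qm_step\<close>, restricted to the unit interval, has that property, so uniqueness
  identifies the two and the functional equation carries over.\<close>

lemma question_mark_step:
  assumes x: "x \<in> {0..1}"
  shows "qm_step question_mark x = question_mark x"
proof -
  obtain g where g: "qm_good g" and fp: "\<And>x. x \<in> {0..1} \<Longrightarrow> qm_step g x = g x"
    using qm_fixed_point_exists by blast
  define f where "f = restrict g {0..1}"
  have fg: "f x = g x" if "x \<in> {0..1}" for x using that by (simp add: f_def)
  have "is_question_mark f"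
    unfolding is_question_mark_def
  proof (intro conjI allI impI)
    show "f \<in> {0..1} \<rightarrow>\<^sub>E {0..1}" using qm_good_bounds[OF g] by (auto simp: f_def)
    show "continuous_on {0..1} f"
      using g continuous_on_cong[of "{0..1}" "{0..1}" f g] fg by (auto simp: qm_good_def)
    show "mono_on {0..1} f" using g by (auto simp: qm_good_def mono_on_def f_def)
    show "f 0 = 0" "f 1 = 1" using g by (auto simp: qm_good_def f_def)
    fix p q p' q' :: nat
    assume a: "0 < q \<and> 0 < q' \<and> coprime p q \<and> coprime p' q' \<and>
        consecutive_farey (real p / real q) (real p' / real q')"
    then have d: "int p' * int q = int p * int q' + 1" "p' \<le> q'"
      using consecutive_fareyD by blast+
    have "real p / real q < real p' / real q'" using a unfolding consecutive_farey_def by blast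
    moreover have "real p' / real q' \<le> 1" using d a by simp
    ultimately have "real p / real q \<le> 1" by linarith
    then have "p \<le> q" using a by simp
    then show "f (real (p + p') / real (q + q')) = (f (real p / real q) + f (real p' / real q')) / 2"
      using qm_fixed_point_mediant[OF g fp _ _ d] a d by (simp add: fg)
  qed
  then have f: "question_mark = f"
    using is_question_mark_unique is_question_mark_question_mark by blast
  have "x / (1 - x) \<in> {0..1}" if "x \<le> 1/2" using x that by (auto simp: field_simps)
  moreover have "(1 - x) / x \<in> {0..1}" if "\<not> x \<le> 1/2" using x that by (auto simp: field_simps)
  ultimately show ?thesis using fp[OF x] x unfolding f by (auto simp: qm_step_def fg)
qed

lemma question_mark_0 [simp]: "question_mark 0 = 0"
  and question_mark_1 [simp]: "question_mark 1 = 1"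
  and question_mark_mono: "mono_on {0..1} question_mark"
  using is_question_mark_question_mark by (auto simp: is_question_mark_def)

lemma question_mark_bounds:
  assumes "0 \<le> y" "y \<le> 1"
  shows "0 \<le> question_mark y" "question_mark y \<le> 1"
  using mono_onD[OF question_mark_mono, of 0 y] mono_onD[OF question_mark_mono, of y 1] assms by auto

text \<open>The right branch of \<open>qm_step\<close> settles the digit 1. On the left branch x /
  (1 - x) lowers the first digit by one, so each further unit halves the value.\<close>

lemma question_mark_inverse:
  assumes "0 \<le> y" "y \<le> 1" "1 \<le> a"
  shows "question_mark (1 / (real a + y)) = (2 - question_mark y) / 2 ^ a"
  using assms(3)
proof (induction a rule: dec_induct)
  case base
  show ?case
  \<comment> \<open>For \<open>y = 1\<close> the point is 1/2, which \<open>qm_step\<close> treats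
    in its left branch.\<close>
  proof (cases "y = 1")
    case True
    then show ?thesis using question_mark_step[of "1/2"] by (simp add: qm_step_def)
  next
    case False
    then have "\<not> 1 / (1 + y) \<le> 1/2" "1 / (1 + y) \<in> {0..1}" using assms by (auto simp: field_simps)
    moreover have "(1 - 1 / (1 + y)) / (1 / (1 + y)) = y" using assms by (simp add: field_simps)
    ultimately have "question_mark (1 / (1 + y)) = 1 - question_mark y / 2"
      using question_mark_step[of "1 / (1 + y)"] by (simp only: qm_step_def if_False)
    then show ?thesis by simp
  qed
next
  case (step a)
  let ?x = "1 / (real (Suc a) + y)"
  have "?x \<le> 1/2" "?x \<in> {0..1}" using assms step by (auto simp: field_simps)
  moreover have "?x / (1 - ?x) = 1 / (real a + y)" using assms step by (simp add: field_simps)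
  ultimately have "question_mark ?x = question_mark (1 / (real a + y)) / 2"
    using question_mark_step[of ?x] by (simp only: qm_step_def if_True)
  then show ?case using step by simp
qed

lemma question_mark_unit_fraction:
  "1 \<le> n \<Longrightarrow> question_mark (1 / real n) = 2 / 2 ^ n"
  using question_mark_inverse[of 0 n] by simp

text \<open>The map x to 1 - x exchanges the two branches of \<open>qm_step\<close>; only the
  midpoint is treated apart.\<close>

lemma question_mark_reflect:
  assumes "0 \<le> x" "x \<le> 1"
  shows "question_mark (1 - x) = 1 - question_mark x"
proof -
  have half: "question_mark (1/2) = 1/2" using question_mark_step[of "1/2"] by (simp add: qm_step_def)
  have *: "question_mark (1 - x) = 1 - question_mark x" if "0 \<le> x" "x < 1/2" for x
    using that question_mark_step[of x] question_mark_step[of "1 - x"] by (simp add: qm_step_def)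
  consider "x < 1/2" | "x = 1/2" | "1/2 < x" by linarith
  then show ?thesis
  proof cases
    case 2
    then show ?thesis using half by (simp only: 2) simp
  qed (use *[of x] *[of "1 - x"] assms in auto)
qed

section \<open>Slope bounds at 0, 1 and the unit fractions\<close>

lemma unit_fraction_interval:
  fixes u :: real
  assumes "0 < u" "u \<le> 1"
  obtains b v where "1 \<le> b" "0 \<le> v" "v < 1" "u = 1 / (real b + v)"
proof -
  have 1: "1 \<le> 1 / u" using assms by simp
  define b where "b = nat \<lfloor>1 / u\<rfloor>"
  have "1 \<le> \<lfloor>1 / u\<rfloor>" using 1 by (simp add: le_floor_iff del: one_le_floor)
  then have b: "real b = of_int \<lfloor>1 / u\<rfloor>" "1 \<le> b" unfolding b_def by linarith+
  have "u = 1 / (real b + frac (1 / u))" using b by (simp add: frac_def)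
  then show thesis using that[of b "frac (1 / u)"] b frac_lt_1 frac_ge_0 by blast
qed

lemma Suc_le_power2: "real b + 1 \<le> 2 ^ b"
  using of_nat_mono[OF Suc_leI[OF less_exp[of b]], where 'a = real] by simp

text \<open>The quotient of the two growth rates peaks at \<open>b = 2\<close> with 9/4, just below
  5/2. The induction starts there because only from then on does the next square stay below twice
  the current one.\<close>

lemma Suc_square_le_power2: "2 * (real b + 1)\<^sup>2 \<le> 5 * 2 ^ b"
proof (cases "b < 2")
  case True
  then have "b = 0 \<or> b = 1" by auto
  then show ?thesis by (auto simp: power2_eq_square)
next
  case False
  then have "2 \<le> b" by simp
  then show ?thesis
  proof (induction b rule: dec_induct)
    case (step n)
    have "2 * (real (Suc n) + 1)\<^sup>2 \<le> 2 * (2 * (real n + 1)\<^sup>2)"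
      using step(1) mult_mono[of 2 "real n" 2 "real n"] by (simp add: power2_eq_square algebra_simps)
    with step.IH show ?case by simp
  qed (simp add: power2_eq_square)
qed

text \<open>If \<open>b\<close> is the first digit of \<open>u\<close>, then \<open>u\<close> is at
  least 1/(b+1) while its image is at most 2/2^b.\<close>

lemma question_mark_upper:
  assumes "0 \<le> u" "u \<le> 1"
  shows "question_mark u \<le> 2 * u" "question_mark u \<le> 5 * u\<^sup>2"
proof -
  have "question_mark u \<le> 2 * u \<and> question_mark u \<le> 5 * u\<^sup>2"
  proof (cases "u = 0")
    case False
    then obtain b v where b: "1 \<le> b" "0 \<le> v" "v < 1" and u: "u = 1 / (real b + v)"
      using assms unit_fraction_interval[of u] by auto
    have le: "1 / (real b + 1) \<le> u" using b unfolding u by (intro divide_left_mono) auto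
    have "question_mark u = (2 - question_mark v) / 2 ^ b"
      unfolding u using b by (intro question_mark_inverse) auto
    also have "\<dots> \<le> 2 / 2 ^ b" using question_mark_bounds[of v] b by (simp add: divide_right_mono)
    finally have q: "question_mark u \<le> 2 / 2 ^ b" .
    have "2 / 2 ^ b \<le> 2 * (1 / (real b + 1))"
      using Suc_le_power2[of b] by (simp add: field_simps)
    moreover have "2 / 2 ^ b \<le> 5 * (1 / (real b + 1))\<^sup>2"
      using Suc_square_le_power2[of b] by (simp add: power_divide divide_simps)
    moreover have "(1 / (real b + 1))\<^sup>2 \<le> u\<^sup>2" using le by (intro power_mono) auto
    ultimately show ?thesis using q le by linarith
  qed simp
  then show "question_mark u \<le> 2 * u" "question_mark u \<le> 5 * u\<^sup>2" by auto
qed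

lemma question_mark_lower:
  assumes "0 \<le> u" "u \<le> 1"
  shows "1 - question_mark u \<le> 2 * (1 - u)"
  using question_mark_upper(1)[of "1 - u"] question_mark_reflect[of u] assms by simp

text \<open>The constant is uniform in \<open>n\<close>, so all cylinder boundaries can be treated
  alike. Between 1/n and its neighbouring unit fractions the claim reduces to the linear bound at 0
  or 1 for the next tail; beyond them the distance to 1/n is already large enough.\<close>

lemma question_mark_near_unit_fraction:
  assumes "1 \<le> n" "0 \<le> u" "u \<le> 1"
  shows "\<bar>question_mark u - question_mark (1 / real n)\<bar> \<le> 10 * \<bar>u - 1 / real n\<bar>"
proof -
  note qn = question_mark_unit_fraction[OF assms(1)]
  note qu = question_mark_bounds[OF assms(2,3)]
  have n: "real n > 0" using assms by simp
  have le: "\<bar>c - d\<bar> \<le> 10 * \<bar>x - y\<bar>" "\<bar>d - c\<bar> \<le> 10 * \<bar>y - x\<bar>"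
    if "d - c \<le> 10 * (y - x)" "c \<le> d" "x \<le> y" for c d x y :: real
    using that by auto
  have "2 * (real n * (real n + 1)) \<le> 2 * (real n + 1)\<^sup>2"
    by (simp add: power2_eq_square algebra_simps)
  then have B: "2 * (real n * (real n + 1)) \<le> 5 * 2 ^ n" using Suc_square_le_power2[of n] by linarith
  have B': "2 / 2 ^ n \<le> 5 * (1 / (real n * (real n + 1)))" using B n by (simp add: divide_simps)
  consider "u \<le> 1 / (real n + 1)" | "1 / (real n + 1) < u" "u \<le> 1 / real n"
    | "2 \<le> n" "1 / real n < u" "u \<le> 1 / (real n - 1)" | "2 \<le> n" "1 / (real n - 1) < u"
  proof (cases "n = 1")
    case True
    then show ?thesis using that(1,2) assms by (cases "u \<le> 1/2") auto
  next
    case False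
    then show ?thesis using that assms by linarith
  qed
  then show ?thesis
  proof cases
    case 1
    have "1 / real n - 1 / (real n + 1) = 1 / (real n * (real n + 1))" using n by (simp add: field_simps)
    then have d: "1 / (real n * (real n + 1)) \<le> 1 / real n - u" using 1 by linarith
    have "u \<le> 1 / real n" using d n
      by (smt (verit) divide_nonneg_nonneg mult_nonneg_nonneg)
    then have m: "question_mark u \<le> question_mark (1 / real n)"
      using assms by (intro mono_onD[OF question_mark_mono]) auto
    have "2 / 2 ^ n \<le> 5 * (1 / (real n * (real n + 1)))" by (rule B')
    also have "\<dots> \<le> 10 * (1 / real n - u)" using d \<open>u \<le> 1 / real n\<close> by (intro mult_mono) auto
    finally have "question_mark (1 / real n) - question_mark u \<le> 10 * (1 / real n - u)"
      using qn qu(1) by linarith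
    then show ?thesis using m \<open>u \<le> 1 / real n\<close> by (rule le(1))
  next
    case 2
    define v where "v = 1 / u - real n"
    have u0: "u > 0" using 2 n by (smt (verit) divide_nonneg_nonneg)
    have v: "0 \<le> v" "v \<le> 1" "u = 1 / (real n + v)" using 2 u0 n by (auto simp: v_def field_simps)
    have q: "question_mark u = (2 - question_mark v) / 2 ^ n"
      unfolding v(3) using v assms by (intro question_mark_inverse) auto
    have "question_mark (1 / real n) - question_mark u = question_mark v / 2 ^ n"
      unfolding q qn by (simp add: field_simps)
    also have "\<dots> \<le> 2 * v / 2 ^ n" using question_mark_upper[of v] v by (intro divide_right_mono) auto
    also have "\<dots> \<le> 5 * (v / (real n * (real n + 1)))"
      using mult_right_mono[OF B' v(1)] by (simp add: mult.commute)
    also have "\<dots> \<le> 5 * (v / (real n * (real n + v)))"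
      using v n by (intro mult_left_mono divide_left_mono) auto
    also have "v / (real n * (real n + v)) = 1 / real n - u" unfolding v(3) using v n by (simp add: field_simps)
    also have "5 * (1 / real n - u) \<le> 10 * (1 / real n - u)" using 2 by (intro mult_right_mono) auto
    finally have "question_mark (1 / real n) - question_mark u \<le> 10 * (1 / real n - u)" .
    moreover have "question_mark u \<le> question_mark (1 / real n)"
      using 2 assms by (intro mono_onD[OF question_mark_mono]) auto
    ultimately show ?thesis using 2(2) by (rule le(1))
  next
    case 3
    \<comment> \<open>Just right of 1/n the first digit is n - 1, and 1/n itself has tail 1 for that
      digit; hence the bound at 1 is used.\<close>
    define m where "m = n - 1"
    have m: "real n = real m + 1" "n = Suc m" "1 \<le> m" using 3 by (auto simp: m_def)
    define v where "v = 1 / u - real m"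
    have u0: "u > 0" using 3 n by (smt (verit) divide_nonneg_nonneg)
    have v: "0 \<le> v" "v \<le> 1" "u = 1 / (real m + v)" using 3 u0 m by (auto simp: v_def field_simps)
    have q: "question_mark u = (2 - question_mark v) / 2 ^ m"
      unfolding v(3) using v m by (intro question_mark_inverse) auto
    have "question_mark u - question_mark (1 / real n) = (1 - question_mark v) / 2 ^ m"
    proof -
      have "question_mark (1 / real n) = 1 / 2 ^ m" unfolding qn unfolding m(2) by simp
      then show ?thesis unfolding q by (simp add: diff_divide_distrib)
    qed
    also have "\<dots> \<le> 2 * (1 - v) / 2 ^ m" using question_mark_lower[of v] v by (intro divide_right_mono) auto
    also have "\<dots> \<le> 5 * ((1 - v) / (real n * real n))"
    proof -
      have "2 / 2 ^ m \<le> 5 / (real n * real n)"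
        using Suc_square_le_power2[of m] n unfolding m(1)
        by (simp add: divide_simps power2_eq_square)
      from mult_right_mono[OF this, of "1 - v"] show ?thesis using v by simp
    qed
    also have "\<dots> \<le> 5 * ((1 - v) / (real n * (real m + v)))"
      using v m n by (intro mult_left_mono divide_left_mono mult_pos_pos) auto
    also have "(1 - v) / (real n * (real m + v)) = u - 1 / real n"
      unfolding v(3) using v m by (simp add: field_simps)
    also have "5 * (u - 1 / real n) \<le> 10 * (u - 1 / real n)" using 3 by (intro mult_right_mono) auto
    finally have "question_mark u - question_mark (1 / real n) \<le> 10 * (u - 1 / real n)" .
    moreover have "question_mark (1 / real n) \<le> question_mark u"
      using 3 assms by (intro mono_onD[OF question_mark_mono]) auto
    ultimately show ?thesis using less_imp_le[OF 3(2)] by (rule le(2))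
  next
    case 4
    have "1 / (real n - 1) > 0" using 4 by simp
    then have u0: "u > 0" using 4 by linarith
    \<comment> \<open>Here 1/n is at most u / (1 + u), so the distance is at least half the square
      of \<open>u\<close>, which matches the quadratic bound of
      \<open>question_mark_upper\<close>.\<close>
    have "1 \<le> u * (real n - 1)" using 4 by (simp add: field_simps)
    then have "1 + u \<le> u * real n" by (simp add: algebra_simps)
    then have "1 / real n \<le> u / (1 + u)" using n u0 by (simp add: field_simps)
    moreover have "u - u / (1 + u) = u\<^sup>2 / (1 + u)" using u0 by (simp add: field_simps power2_eq_square)
    moreover have "u\<^sup>2 / 2 \<le> u\<^sup>2 / (1 + u)" using u0 assms by (intro divide_left_mono) auto
    ultimately have d: "u\<^sup>2 / 2 \<le> u - 1 / real n" by linarith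
    then have "1 / real n \<le> u" using zero_le_power2[of u] by linarith
    then have "question_mark (1 / real n) \<le> question_mark u"
      using assms by (intro mono_onD[OF question_mark_mono]) auto
    moreover have "question_mark u - question_mark (1 / real n) \<le> 10 * (u - 1 / real n)"
    proof -
      have "question_mark (1 / real n) \<ge> 0" using qn by simp
      then have "question_mark u - question_mark (1 / real n) \<le> 10 * (u\<^sup>2 / 2)"
        using question_mark_upper(2)[OF assms(2,3)] by simp
      also have "\<dots> \<le> 10 * (u - 1 / real n)" using d by (intro mult_left_mono) auto
      finally show ?thesis .
    qed
    ultimately show ?thesis using \<open>1 / real n \<le> u\<close> by (intro le(2))
  qed
qed

section \<open>Continued fractions with prescribed digits\<close>

text \<open>The continued fraction \<open>[0; a 1, ..., a t + y]\<close> as a function of its tail;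
  the image of \<open>{0..1}\<close> is the cylinder of order \<open>t\<close>.\<close>

fun cf_app :: "(nat \<Rightarrow> nat) \<Rightarrow> nat \<Rightarrow> real \<Rightarrow> real" where
  "cf_app a 0 y = y"
| "cf_app a (Suc t) y = cf_app a t (1 / (real (a (Suc t)) + y))"

text \<open>\<open>cf_den a t\<close> and \<open>cf_den_prev a t\<close> are the denominators \<open>q\<^sub>t\<close> and \<open>q\<^bsub>t-1\<^esub>\<close>.\<close>

fun cf_den :: "(nat \<Rightarrow> nat) \<Rightarrow> nat \<Rightarrow> real" and cf_den_prev :: "(nat \<Rightarrow> nat) \<Rightarrow> nat \<Rightarrow> real" where
  "cf_den a 0 = 1"
| "cf_den a (Suc t) = real (a (Suc t)) * cf_den a t + cf_den_prev a t"
| "cf_den_prev a 0 = 0"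
| "cf_den_prev a (Suc t) = cf_den a t"

definition digit_sum :: "(nat \<Rightarrow> nat) \<Rightarrow> nat \<Rightarrow> nat" where
  "digit_sum a t = (\<Sum>i=1..t. a i)"

lemma digit_sum_simps [simp]:
  "digit_sum a 0 = 0" "digit_sum a (Suc t) = digit_sum a t + a (Suc t)"
  by (simp_all add: digit_sum_def)

locale digits =
  fixes a :: "nat \<Rightarrow> nat"
  assumes a_pos: "\<And>n. 1 \<le> a (Suc n)"
begin

lemma a_ge_1: "1 \<le> real (a (Suc t))"
  using a_pos[of t] by simp

lemma le_digit_mult: "0 \<le> z \<Longrightarrow> z \<le> real (a (Suc t)) * z"
  using mult_right_mono[OF a_ge_1[of t], of z] by (simp only: mult_1_left)

lemma cf_den_bounds: "1 \<le> cf_den a t \<and> 0 \<le> cf_den_prev a t \<and> cf_den_prev a t \<le> cf_den a t"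
proof (induction t)
  case (Suc t)
  then have "cf_den a t \<le> cf_den a (Suc t)"
    using le_digit_mult[of "cf_den a t" t] unfolding cf_den.simps by linarith
  with Suc show ?case unfolding cf_den_prev.simps by linarith
qed simp

lemma cf_den_ge_1: "1 \<le> cf_den a t" and cf_den_pos: "0 < cf_den a t"
  and cf_den_prev_nonneg: "0 \<le> cf_den_prev a t" and cf_den_prev_le: "cf_den_prev a t \<le> cf_den a t"
  using cf_den_bounds[of t] by auto

lemma inverse_digit_bounds:
  assumes "0 \<le> y" "y \<le> 1"
  shows "0 \<le> 1 / (real (a (Suc t)) + y)" "1 / (real (a (Suc t)) + y) \<le> 1"
  using assms a_ge_1[of t] by (auto simp: field_simps)

lemma cf_app_bounds:
  "0 \<le> y \<Longrightarrow> y \<le> 1 \<Longrightarrow> 0 \<le> cf_app a t y \<and> cf_app a t y \<le> 1"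
proof (induction t arbitrary: y)
  case (Suc t)
  then show ?case using Suc.IH[OF inverse_digit_bounds[of y t]] by simp
qed simp

lemma continuous_on_cf_app: "continuous_on {0..1} (cf_app a t)"
proof (induction t)
  case (Suc t)
  have "continuous_on {0..1} (\<lambda>y. cf_app a t (1 / (real (a (Suc t)) + y)))"
  proof (rule continuous_on_compose2[OF Suc])
    show "continuous_on {0..1} (\<lambda>y. 1 / (real (a (Suc t)) + y))"
      using a_ge_1[of t] by (intro continuous_intros) auto
  qed (use inverse_digit_bounds in auto)
  then show ?case by simp
qed (simp add: continuous_on_id)

text \<open>\<open>cf_app a t\<close> is a Moebius map of determinant 1 or -1 with denominator
  \<open>cf_den a t + cf_den_prev a t * y\<close>; absolute values hide the alternating
  sign.\<close>

lemma cf_app_dist: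
  assumes "0 \<le> y" "y \<le> 1" "0 \<le> z" "z \<le> 1"
  shows "\<bar>cf_app a t y - cf_app a t z\<bar> =
    \<bar>y - z\<bar> / ((cf_den a t + cf_den_prev a t * y) * (cf_den a t + cf_den_prev a t * z))"
  using assms
proof (induction t arbitrary: y z)
  case (Suc t)
  let ?A = "real (a (Suc t))" and ?q = "cf_den a t" and ?q' = "cf_den_prev a t"
  have p: "0 < ?A + y" "0 < ?A + z" using a_ge_1[of t] Suc.prems by auto
  have "1 / (?A + y) - 1 / (?A + z) = (z - y) / ((?A + y) * (?A + z))"
    using p by (simp add: field_simps)
  then have d: "\<bar>1 / (?A + y) - 1 / (?A + z)\<bar> = \<bar>y - z\<bar> / ((?A + y) * (?A + z))"
    using p by (simp add: abs_mult abs_minus_commute)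
  have e: "?q + ?q' * (1 / (?A + w)) = (cf_den a (Suc t) + cf_den_prev a (Suc t) * w) / (?A + w)"
    if "0 < ?A + w" for w
    using that by (simp add: field_simps)
  show ?case
    unfolding cf_app.simps using p
    by (subst Suc.IH) (simp_all only: inverse_digit_bounds Suc.prems d e, simp)
qed simp

lemma question_mark_cf_app_dist:
  assumes "0 \<le> y" "y \<le> 1" "0 \<le> z" "z \<le> 1"
  shows "\<bar>question_mark (cf_app a t y) - question_mark (cf_app a t z)\<bar> =
    \<bar>question_mark y - question_mark z\<bar> / 2 ^ digit_sum a t"
  using assms
proof (induction t arbitrary: y z)
  case (Suc t)
  have "question_mark (1 / (real (a (Suc t)) + y)) - question_mark (1 / (real (a (Suc t)) + z)) =
      (question_mark z - question_mark y) / 2 ^ a (Suc t)"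
    using question_mark_inverse a_pos[of t] Suc.prems by (simp add: diff_divide_distrib)
  then have "\<bar>question_mark (1 / (real (a (Suc t)) + y)) - question_mark (1 / (real (a (Suc t)) + z))\<bar> =
      \<bar>question_mark y - question_mark z\<bar> / 2 ^ a (Suc t)"
    by (simp add: abs_minus_commute)
  then show ?case
    unfolding cf_app.simps
    by (subst Suc.IH) (simp_all only: inverse_digit_bounds Suc.prems, simp add: power_add mult.commute)
qed simp

lemma inj_on_cf_app: "inj_on (cf_app a t) {0..1}"
proof (rule inj_onI)
  fix y z :: real assume yz: "y \<in> {0..1}" "z \<in> {0..1}" "cf_app a t y = cf_app a t z"
  have "0 < (cf_den a t + cf_den_prev a t * y) * (cf_den a t + cf_den_prev a t * z)"
    using yz cf_den_pos[of t] cf_den_prev_nonneg[of t] by (intro mult_pos_pos add_pos_nonneg) auto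
  then show "y = z" using cf_app_dist[of y z t] yz by auto
qed

lemma cf_app_dist_bounds:
  assumes "0 \<le> y" "y \<le> 1" "0 \<le> z" "z \<le> 1"
  shows "\<bar>y - z\<bar> / (4 * (cf_den a t)\<^sup>2) \<le> \<bar>cf_app a t y - cf_app a t z\<bar>"
    and "\<bar>cf_app a t y - cf_app a t z\<bar> \<le> \<bar>y - z\<bar> / (cf_den a t)\<^sup>2"
proof -
  note q = cf_den_pos[of t] cf_den_prev_nonneg[of t] cf_den_prev_le[of t]
  have b: "cf_den a t \<le> cf_den a t + cf_den_prev a t * w" "cf_den a t + cf_den_prev a t * w \<le> 2 * cf_den a t"
    if "0 \<le> w" "w \<le> 1" for w
    using that q mult_mono[of "cf_den_prev a t" "cf_den a t" w 1] by auto
  have "cf_den a t * cf_den a t \<le> (cf_den a t + cf_den_prev a t * y) * (cf_den a t + cf_den_prev a t * z)"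
    using b[of y] b[of z] assms q by (intro mult_mono) auto
  moreover have "(cf_den a t + cf_den_prev a t * y) * (cf_den a t + cf_den_prev a t * z) \<le> (2 * cf_den a t) * (2 * cf_den a t)"
    using b[of y] b[of z] assms q by (intro mult_mono) auto
  moreover have "0 < cf_den a t * cf_den a t" using q by simp
  ultimately show "\<bar>y - z\<bar> / (4 * (cf_den a t)\<^sup>2) \<le> \<bar>cf_app a t y - cf_app a t z\<bar>"
    "\<bar>cf_app a t y - cf_app a t z\<bar> \<le> \<bar>y - z\<bar> / (cf_den a t)\<^sup>2"
    unfolding cf_app_dist[OF assms] power2_eq_square
    by (intro divide_left_mono; simp)+
qed

text \<open>From the second step on, each denominator exceeds its predecessor by at least 1. Two
  consecutive indices are carried along because the first digit may be 1, so growth need not start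
  at once.\<close>

lemma cf_den_ge_linear: "real t \<le> 2 * cf_den a t \<and> real t + 1 \<le> 2 * cf_den a (Suc t)"
proof (induction t)
  case 0
  then show ?case using a_ge_1[of 0] by simp
next
  case (Suc t)
  have "cf_den a (Suc t) + cf_den a t \<le> cf_den a (Suc (Suc t))"
    using le_digit_mult[of "cf_den a (Suc t)" "Suc t"] cf_den_pos[of "Suc t"]
    unfolding cf_den.simps(2)[of a "Suc t"] cf_den_prev.simps by linarith
  then show ?case using Suc cf_den_ge_1[of t] cf_den_ge_1[of "Suc t"] by linarith
qed

lemma filterlim_cf_den: "filterlim (cf_den a) at_top sequentially"
proof (rule filterlim_at_top_mono)
  show "filterlim (\<lambda>t. real t / 2) at_top sequentially" by real_asymp
  show "\<forall>\<^sub>F t in sequentially. real t / 2 \<le> cf_den a t"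
    using cf_den_ge_linear by (intro always_eventually) (auto simp: field_simps)
qed

lemma inverse_cf_den_square_tendsto_0: "(\<lambda>t. 1 / (cf_den a t)\<^sup>2) \<longlonglongrightarrow> 0"
  using filterlim_cf_den
  by (intro tendsto_divide_0[OF tendsto_const] filterlim_at_top_imp_at_infinity
        filterlim_pow_at_top) auto

end

section \<open>The extremal growth of denominators\<close>

definition lam4 :: real where "lam4 = 2 + sqrt 5"
definition lam5 :: real where "lam5 = (5 + sqrt 29) / 2"

lemma lam4_approx: "4.236067 < lam4" "lam4 < 4.236068"
  unfolding lam4_def using real_less_rsqrt[of "2.236067" 5] real_less_lsqrt[of "2.236068" 5]
  by (simp_all add: power2_eq_square)

lemma lam5_approx: "5.192582 < lam5" "lam5 < 5.1925825"
  unfolding lam5_def using real_less_rsqrt[of "5.385164" 29] real_less_lsqrt[of "5.385165" 29]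
  by (simp_all add: power2_eq_square)

lemma lam_pos: "0 < lam4" "0 < lam5" using lam4_approx lam5_approx by linarith+

lemma inverse_lam4: "1 / lam4 = lam4 - 4" and inverse_lam5: "1 / lam5 = lam5 - 5"
proof -
  have "lam4 * (lam4 - 4) = 1" "lam5 * (lam5 - 5) = 1"
    by (simp_all add: lam4_def lam5_def field_simps flip: power2_eq_square)
  then show "1 / lam4 = lam4 - 4" "1 / lam5 = lam5 - 5"
    using lam_pos by (simp_all add: field_simps)
qed

text \<open>The weight for which the digits 4 and 5 are both neutral: \<open>digit_weight 4 = lam4\<close>
  and \<open>digit_weight 5 = lam5\<close> are the spectral radii of the matrices of these digits.\<close>

definition digit_weight :: "nat \<Rightarrow> real" where
  "digit_weight n = lam4 ^ 5 / lam5 ^ 4 * (lam5 / lam4) ^ n"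

lemma digit_weight_pos: "0 < digit_weight n"
  using lam_pos by (simp add: digit_weight_def)

lemma digit_weight_Suc: "digit_weight (Suc n) = digit_weight n * (lam5 / lam4)"
  by (simp add: digit_weight_def)

lemma digit_weight_4: "digit_weight 4 = lam4" and digit_weight_5: "digit_weight 5 = lam5"
  using lam_pos by (simp_all add: digit_weight_def field_simps power_numeral_reduce)

lemma lam_ratio: "1.22 \<le> lam5 / lam4" "lam5 / lam4 \<le> 1.225803"
  using lam4_approx lam5_approx by (simp_all add: field_simps)

text \<open>Descends from \<open>digit_weight 4 = lam4\<close>, dividing by the upper bound of the
  ratio for each digit.\<close>

lemma digit_weight_3: "3.4557 \<le> digit_weight 3"
  and digit_weight_2: "2.819 \<le> digit_weight 2"
  and digit_weight_1: "2.29 \<le> digit_weight 1"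
proof -
  have r: "lower / 1.225803 \<le> digit_weight n"
    if "lower \<le> digit_weight (Suc n)" for n lower
  proof -
    have "lower \<le> digit_weight n * 1.225803"
      using that mult_left_mono[OF lam_ratio(2), of "digit_weight n"] digit_weight_pos[of n]
      unfolding digit_weight_Suc by linarith
    then show ?thesis by (simp add: field_simps)
  qed
  have "4.236067 \<le> digit_weight (Suc 3)" using lam4_approx digit_weight_4 by simp
  from r[OF this] show 3: "3.4557 \<le> digit_weight 3" by simp
  have "3.4557 \<le> digit_weight (Suc 2)" using 3 by (simp add: numeral_eq_Suc)
  from r[OF this] show 2: "2.819 \<le> digit_weight 2" by simp
  have "2.819 \<le> digit_weight (Suc 1)" using 2 by (simp add: numeral_eq_Suc)
  from r[OF this] show "2.29 \<le> digit_weight 1" by simp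
qed

lemma digit_weight_ge:
  assumes "6 \<le> n"
  shows "1.05 * real n \<le> digit_weight n"
  using assms
proof (induction n rule: dec_induct)
  case base
  have "6.3 \<le> lam5 * 1.22" using lam5_approx by simp
  also have "\<dots> \<le> digit_weight (Suc 5)"
    unfolding digit_weight_Suc digit_weight_5 using lam_ratio lam_pos by (intro mult_left_mono) auto
  finally show ?case by simp
next
  case (step n)
  have "(1.05 * real n) * 1.22 \<le> digit_weight (Suc n)"
    unfolding digit_weight_Suc using step lam_ratio by (intro mult_mono) auto
  then show ?case using step by simp
qed

section \<open>Contraction of the potential under one digit\<close>

lemma affine_le:
  fixes y :: real
  assumes "l * q \<le> y" "y \<le> u * q" "l < u"
    and "A + B * l \<le> C + D * l" "A + B * u \<le> C + D * u"
  shows "A * q + B * y \<le> C * q + D * y"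
proof -
  \<comment> \<open>Both sides are linear in the pair, so on the cone between two rays the
    inequality is a nonnegative combination of its instances on these rays.\<close>
  have "0 \<le> (u * q - y) * ((C + D * l) - (A + B * l)) + (y - l * q) * ((C + D * u) - (A + B * u))"
    using assms by (intro add_nonneg_nonneg mult_nonneg_nonneg) auto
  also have "\<dots> = (u - l) * ((C * q + D * y) - (A * q + B * y))" by (simp add: algebra_simps)
  finally show ?thesis using assms(3) by (simp add: zero_le_mult_iff)
qed

text \<open>Reduces a contraction of forms with irrational coefficients to two decimal inequalities:
  \<open>\<alpha>'\<close> and \<open>i'\<close> bound the new form from above, \<open>L\<close>,
  \<open>\<beta>'\<close> and \<open>j'\<close> bound the weight and the old form from below, and
  \<open>e\<close> tests the extreme ratios of \<open>y\<close> to \<open>q\<close>.\<close>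

lemma contraction_step:
  fixes y :: real
  assumes y: "l * q \<le> y" "y \<le> u * q" and l: "0 \<le> l" "l < u"
    and b: "0 \<le> \<alpha>" "\<alpha> \<le> \<alpha>'" "0 \<le> n + i" "i \<le> i'" "L \<le> w" "0 \<le> L" "0 \<le> \<beta>'" "\<beta>' \<le> \<beta>" "0 \<le> j'" "j' \<le> j"
    and e: "\<alpha>' * (n + i' + l) \<le> 0.9999 * (L * (\<beta>' * (1 + j' * l)))"
       "\<alpha>' * (n + i' + u) \<le> 0.9999 * (L * (\<beta>' * (1 + j' * u)))"
  shows "\<alpha> * ((n * q + y) + i * q) \<le> 0.9999 * (w * (\<beta> * (q + j * y)))"
proof -
  have *: "\<alpha> * (n + i) + \<alpha> * z \<le> 0.9999 * (w * \<beta>) + 0.9999 * (w * (\<beta> * j)) * z"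
    if z: "0 \<le> z" "\<alpha>' * (n + i' + z) \<le> 0.9999 * (L * (\<beta>' * (1 + j' * z)))" for z
  proof -
    have "\<alpha> * (n + i + z) \<le> \<alpha>' * (n + i' + z)" using b z by (intro mult_mono) auto
    also note z(2)
    also have "0.9999 * (L * (\<beta>' * (1 + j' * z))) \<le> 0.9999 * (w * (\<beta> * (1 + j * z)))"
      using b z by (intro mult_left_mono mult_mono add_left_mono mult_right_mono) auto
    finally show ?thesis by (simp add: algebra_simps)
  qed
  have "\<alpha> * (n + i) * q + \<alpha> * y \<le> 0.9999 * (w * \<beta>) * q + 0.9999 * (w * (\<beta> * j)) * y"
    using y l * e by (intro affine_le) auto
  then show ?thesis by (simp add: algebra_simps)
qed

text \<open>Left eigenforms of the digits 4 and 5, scaled to agree at \<open>q = 5 * y\<close>: the next pair satisfies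
  \<open>q \<le> 5 * y\<close> after a digit at most 4 and \<open>5 * y \<le> q\<close> after a digit at least 5.\<close>

definition form4 :: "real \<Rightarrow> real \<Rightarrow> real" where
  "form4 q y = lam5 * (q + (lam4 - 4) * y)"
definition form5 :: "real \<Rightarrow> real \<Rightarrow> real" where
  "form5 q y = (lam4 + 1) * (q + (lam5 - 5) * y)"

definition potential :: "real \<Rightarrow> real \<Rightarrow> real" where
  "potential q y = max (form4 q y) (form5 q y)"

lemma form_diff: "form4 q y - form5 q y = (lam4 - lam5 + 1) * (5 * y - q)"
  by (simp add: form4_def form5_def algebra_simps)

lemma form_le_iff: "form5 q y \<le> form4 q y \<longleftrightarrow> q \<le> 5 * y" "form4 q y \<le> form5 q y \<longleftrightarrow> 5 * y \<le> q"
proof -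
  have p: "0 < lam4 - lam5 + 1" using lam4_approx lam5_approx by simp
  have "form5 q y \<le> form4 q y \<longleftrightarrow> 0 \<le> (lam4 - lam5 + 1) * (5 * y - q)" 
    using form_diff[of q y] by linarith
  then show "form5 q y \<le> form4 q y \<longleftrightarrow> q \<le> 5 * y" using p by (simp add: zero_le_mult_iff)
  have "form4 q y \<le> form5 q y \<longleftrightarrow> (lam4 - lam5 + 1) * (5 * y - q) \<le> 0" 
    using form_diff[of q y] by linarith
  then show "form4 q y \<le> form5 q y \<longleftrightarrow> 5 * y \<le> q" using p by (simp add: mult_le_0_iff)
qed

lemma potential_high: "q \<le> 5 * y \<Longrightarrow> potential q y = form4 q y"
  and potential_low: "5 * y \<le> q \<Longrightarrow> potential q y = form5 q y"
  using form_le_iff[of q y] by (simp_all add: potential_def max_absorb1 max_absorb2)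

lemma form4_step: "form4 (4 * q + y) q = lam4 * form4 q y"
  and form5_step: "form5 (5 * q + y) q = lam5 * form5 q y"
proof -
  have "lam4 * (lam4 - 4) = 1" "lam5 * (lam5 - 5) = 1"
    using inverse_lam4 inverse_lam5 lam_pos by (simp_all add: field_simps)
  then have e: "lam4 * lam4 = 1 + 4 * lam4" "lam5 * lam5 = 1 + 5 * lam5" by (simp_all add: algebra_simps)
  have "form4 (4 * q + y) q - lam4 * form4 q y = lam5 * ((1 + 4 * lam4 - lam4 * lam4) * y)"
    by (simp add: form4_def algebra_simps)
  then show "form4 (4 * q + y) q = lam4 * form4 q y" using e by simp
  have "form5 (5 * q + y) q - lam5 * form5 q y = (lam4 + 1) * ((1 + 5 * lam5 - lam5 * lam5) * y)"
    by (simp add: form5_def algebra_simps)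
  then show "form5 (5 * q + y) q = lam5 * form5 q y" using e by simp
qed

text \<open>A digit up to 3 leads to the side where \<open>form4\<close> is the maximum, a digit
  from 6 on to the side of \<open>form5\<close>. With the two positions of the old pair this leaves
  four comparisons of single linear forms. The factor 0.9999 also has to serve
  \<open>potential_5_after_4\<close>, where the margin is thinnest.\<close>

lemma potential_contracts:
  assumes "0 < q" "0 \<le> y" "y \<le> q" "1 \<le> n" "n \<noteq> 4" "n \<noteq> 5"
  shows "potential (real n * q + y) q \<le> 0.9999 * (digit_weight n * potential q y)"
proof -
  note lams = lam4_approx lam5_approx
  consider "n = 1" | "n = 2" | "n = 3" | "6 \<le> n" using assms by linarith
  then have w: "n \<le> 3 \<and> (n = 1 \<and> 2.29 \<le> digit_weight n \<or> n = 2 \<and> 2.819 \<le> digit_weight n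
      \<or> n = 3 \<and> 3.4557 \<le> digit_weight n) \<or> 6 \<le> n \<and> 1.05 * real n \<le> digit_weight n"
    by cases (use digit_weight_1 digit_weight_2 digit_weight_3 digit_weight_ge in auto)
  show ?thesis
  proof (cases "q \<le> 5 * y")
    case high: True
    then have V: "potential q y = form4 q y" by (rule potential_high)
    show ?thesis
      using w
    proof (elim disjE conjE)
      assume n: "n \<le> 3"
      then have "real n * q \<le> 3 * q" using assms by (intro mult_right_mono) auto
      then have new: "potential (real n * q + y) q = form4 (real n * q + y) q"
        using assms by (intro potential_high) linarith
      \<comment> \<open>The conditions belong to the rays \<open>y = q / 5\<close> and
        \<open>y = q\<close>, with \<open>lam5\<close> and \<open>lam4 - 4\<close> rounded up on the
        left and down on the right.\<close>
      have *: ?thesis if "L \<le> digit_weight n" "0 \<le> L"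
        "5.1925825 * (real n + 0.236068 + 1/5) \<le> 0.9999 * (L * (5.192582 * (1 + 0.236067 * (1/5))))"
        "5.1925825 * (real n + 0.236068 + 1) \<le> 0.9999 * (L * (5.192582 * (1 + 0.236067 * 1)))" for L
        unfolding new V form4_def
        by (rule contraction_step[where l = "1/5" and u = 1 and \<alpha>' = "5.1925825" and i' = "0.236068"
              and L = L and \<beta>' = "5.192582" and j' = "0.236067"])
           (use that assms high lams in auto)
      {
        assume "n = 1" "2.29 \<le> digit_weight n"
        then show ?thesis by (intro *[of "2.29"]) simp_all
      next
        assume "n = 2" "2.819 \<le> digit_weight n"
        then show ?thesis by (intro *[of "2.819"]) simp_all
      next
        assume "n = 3" "3.4557 \<le> digit_weight n"
        then show ?thesis by (intro *[of "3.4557"]) simp_all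
      }
    next
      assume n: "6 \<le> n" "1.05 * real n \<le> digit_weight n"
      then have "5 * q \<le> real n * q" using assms by (intro mult_right_mono) auto
      then have new: "potential (real n * q + y) q = form5 (real n * q + y) q"
        using assms by (intro potential_low) linarith
      \<comment> \<open>With \<open>L = 1.05 * real n\<close> both ray conditions are linear in
        \<open>n\<close>, so one check covers all digits from 6 on.\<close>
      show ?thesis
        unfolding new V form4_def form5_def
        by (rule contraction_step[where l = "1/5" and u = 1 and \<alpha>' = "5.236068" and i' = "0.1925825"
              and L = "1.05 * real n" and \<beta>' = "5.192582" and j' = "0.236067"])
           (use n assms high lams in auto)
    qed
  next
    case low: False
    then have V: "potential q y = form5 q y" by (intro potential_low) simp
    show ?thesis
      using w
    proof (elim disjE conjE)
      assume n: "n \<le> 3"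
      then have "real n * q \<le> 3 * q" using assms by (intro mult_right_mono) auto
      then have new: "potential (real n * q + y) q = form4 (real n * q + y) q"
        using assms by (intro potential_high) linarith
      \<comment> \<open>Now the rays are \<open>y = 0\<close> and \<open>y = q / 5\<close>, and the
        right sides contain lower bounds of \<open>lam4 + 1\<close> and
        \<open>lam5 - 5\<close>.\<close>
      have *: ?thesis if "L \<le> digit_weight n" "0 \<le> L"
        "5.1925825 * (real n + 0.236068 + 0) \<le> 0.9999 * (L * (5.236067 * (1 + 0.192582 * 0)))"
        "5.1925825 * (real n + 0.236068 + 1/5) \<le> 0.9999 * (L * (5.236067 * (1 + 0.192582 * (1/5))))" for L
        unfolding new V form4_def form5_def
        by (rule contraction_step[where l = 0 and u = "1/5" and \<alpha>' = "5.1925825" and i' = "0.236068"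
              and L = L and \<beta>' = "5.236067" and j' = "0.192582"])
           (use that assms low lams in auto)
      {
        assume "n = 1" "2.29 \<le> digit_weight n"
        then show ?thesis by (intro *[of "2.29"]) simp_all
      next
        assume "n = 2" "2.819 \<le> digit_weight n"
        then show ?thesis by (intro *[of "2.819"]) simp_all
      next
        assume "n = 3" "3.4557 \<le> digit_weight n"
        then show ?thesis by (intro *[of "3.4557"]) simp_all
      }
    next
      assume n: "6 \<le> n" "1.05 * real n \<le> digit_weight n"
      then have "5 * q \<le> real n * q" using assms by (intro mult_right_mono) auto
      then have new: "potential (real n * q + y) q = form5 (real n * q + y) q"
        using assms by (intro potential_low) linarith
      show ?thesis
        unfolding new V form5_def
        by (rule contraction_step[where l = 0 and u = "1/5" and \<alpha>' = "5.236068" and i' = "0.1925825"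
              and L = "1.05 * real n" and \<beta>' = "5.236067" and j' = "0.192582"])
           (use n assms low lams in auto)
    qed
  qed
qed

lemma potential_4:
  assumes "0 \<le> y" "y \<le> q"
  shows "potential (4 * q + y) q \<le> digit_weight 4 * potential q y"
proof -
  have "potential (4 * q + y) q = lam4 * form4 q y"
    using potential_high[of "4 * q + y" q] form4_step assms by simp
  also have "\<dots> \<le> lam4 * potential q y" using lam_pos by (intro mult_left_mono) (auto simp: potential_def)
  finally show ?thesis by (simp add: digit_weight_4)
qed

text \<open>The right side keeps \<open>form5\<close>: its distance below \<open>potential\<close>
  is what a digit 5 loses.\<close>

lemma potential_5:
  assumes "0 \<le> y"
  shows "potential (5 * q + y) q = digit_weight 5 * form5 q y"
  using potential_low[of q "5 * q + y"] form5_step assms by (simp add: digit_weight_5)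

lemma potential_nonincreasing:
  assumes "0 < q" "0 \<le> y" "y \<le> q" "1 \<le> n"
  shows "potential (real n * q + y) q \<le> digit_weight n * potential q y"
proof -
  consider "n = 4" | "n = 5" | "n \<noteq> 4" "n \<noteq> 5" by blast
  then show ?thesis
  proof cases
    case 1
    then show ?thesis using potential_4 assms by simp
  next
    case 2
    have "digit_weight 5 * form5 q y \<le> digit_weight 5 * potential q y"
      using digit_weight_pos[of 5] by (intro mult_left_mono) (auto simp: potential_def)
    then show ?thesis using potential_5 assms 2 by simp
  next
    case 3
    have "0 \<le> form4 q y" using lam4_approx lam5_approx assms by (simp add: form4_def)
    then have "0 \<le> potential q y" by (simp add: potential_def le_max_iff_disj)
    then have "0.9999 * (digit_weight n * potential q y) \<le> digit_weight n * potential q y"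
      using digit_weight_pos[of n] by simp
    then show ?thesis using potential_contracts[of q y n] assms 3 by linarith
  qed
qed

text \<open>After a 4 whose predecessor is at least 4, \<open>q\<close> is at most 4 + 1/4 times
  \<open>y\<close>, whence 17/4. This is below 5, so \<open>form5\<close> stays below
  \<open>form4\<close> by a fixed factor.\<close>

lemma potential_5_after_4:
  assumes "0 < q" "y \<le> q" "4 * q \<le> 17 * y"
  shows "potential (5 * q + y) q \<le> 0.9999 * (digit_weight 5 * potential q y)"
proof -
  have "form5 q y = (lam4 + 1) * q + (lam4 + 1) * (lam5 - 5) * y" by (simp add: form5_def algebra_simps)
  also have "\<dots> \<le> 0.9999 * lam5 * q + 0.9999 * lam5 * (lam4 - 4) * y"
  proof -
    have *: "(lam4 + 1) + (lam4 + 1) * (lam5 - 5) * z \<le> 0.9999 * lam5 + 0.9999 * lam5 * (lam4 - 4) * z"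
      if z: "0 \<le> z" "5.236068 * (1 + 0.1925825 * z) \<le> 0.9999 * 5.192582 * (1 + 0.236067 * z)" for z
    proof -
      have "(lam4 + 1) * (1 + (lam5 - 5) * z) \<le> 5.236068 * (1 + 0.1925825 * z)"
        using lam4_approx lam5_approx z by (intro mult_mono add_left_mono mult_right_mono) auto
      also note z(2)
      also have "0.9999 * 5.192582 * (1 + 0.236067 * z) \<le> 0.9999 * lam5 * (1 + (lam4 - 4) * z)"
        using lam4_approx lam5_approx z by (intro mult_mono add_left_mono mult_right_mono) auto
      finally show ?thesis by (simp only: distrib_left mult.assoc mult_1_right)
    qed
    show ?thesis
      using assms *[of "4/17"] *[of 1] by (intro affine_le[of "4/17" _ _ 1]) auto
  qed
  also have "\<dots> = 0.9999 * form4 q y" by (simp only: form4_def distrib_left mult.assoc)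
  also have "\<dots> \<le> 0.9999 * potential q y" by (simp add: potential_def)
  finally have "digit_weight 5 * form5 q y \<le> digit_weight 5 * (0.9999 * potential q y)"
    using digit_weight_pos[of 5] by (intro mult_left_mono) auto
  then show ?thesis using potential_5[of y q] assms by simp
qed

lemma potential_bounds:
  assumes "0 \<le> y" "y \<le> q"
  shows "q \<le> potential q y" "potential q y \<le> 10 * q"
proof -
  have "1 * q \<le> lam5 * q" using lam5_approx assms by (intro mult_right_mono) auto
  moreover have "lam5 * q \<le> form4 q y"
    using lam4_approx lam5_approx assms by (simp add: form4_def)
  ultimately show "q \<le> potential q y" by (simp add: potential_def)
  have "form4 q y \<le> 5.1925825 * (q + 0.236068 * q)"
    unfolding form4_def using lam4_approx lam5_approx assms by (intro mult_mono add_mono) auto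
  moreover have "form5 q y \<le> 5.236068 * (q + 0.1925825 * q)"
    unfolding form5_def using lam4_approx lam5_approx assms by (intro mult_mono add_mono) auto
  ultimately show "potential q y \<le> 10 * q" using assms by (simp add: potential_def)
qed

section \<open>The condition on the digit sums\<close>

text \<open>The negated denominator of \<open>kappa2\<close>, and the rate called \<beta> in the
  overview.\<close>

definition growth_gap :: real where
  "growth_gap = ln (sqrt 2) + ln lam4 - ln lam5"

lemma growth_gap_pos: "0 < growth_gap"
proof -
  have "1.4 < sqrt 2" by (rule real_less_rsqrt) (simp add: power2_eq_square)
  then have "lam5 < sqrt 2 * lam4"
    using lam4_approx lam5_approx mult_strict_mono[of "1.4" "sqrt 2" "4.236067" lam4] by simp
  then have "ln lam5 < ln (sqrt 2 * lam4)" using lam_pos by simp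
  then show ?thesis using lam_pos by (simp add: growth_gap_def ln_mult)
qed

lemma kappa2_growth_gap: "kappa2 * growth_gap = 5 * ln lam4 - 4 * ln lam5"
proof -
  have "kappa2 = (4 * ln lam5 - 5 * ln lam4) / - growth_gap"
    by (simp add: kappa2_def growth_gap_def lam4_def lam5_def)
  then show ?thesis using growth_gap_pos by (simp add: field_simps)
qed

text \<open>Constant digits decide both bounds: the first amounts to lam4^2 > 2^4, the second to
  lam5^2 < 2^5. Thus runs of 4 raise the slope and runs of 5 lower it.\<close>

lemma kappa2_gt_4: "4 < kappa2" and kappa2_lt_5: "kappa2 < 5"
proof -
  have sqrt2: "ln (sqrt 2) = ln 2 / 2" by (simp add: ln_sqrt)
  have "2 * ln 2 = ln ((2::real) ^ 2)" by (subst ln_realpow) auto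
  also have "\<dots> < ln lam4" using lam4_approx by simp
  finally have l4: "2 * ln 2 < ln lam4" .
  have "4 * (u / 2 + v - w) < 5 * v - 4 * w" if "2 * u < v" for u v w :: real
    using that by simp
  from this[OF l4] have "4 * growth_gap < 5 * ln lam4 - 4 * ln lam5"
    unfolding growth_gap_def sqrt2 .
  then have "4 * growth_gap < kappa2 * growth_gap" by (simp only: kappa2_growth_gap)
  then show "4 < kappa2" using growth_gap_pos by simp
  have "lam5 ^ 2 < 5.2 ^ 2" using lam5_approx by (intro power_strict_mono) auto
  then have "lam5 ^ 2 < 2 ^ 5" by (simp add: power2_eq_square)
  then have "ln (lam5 ^ 2) < ln (2 ^ 5)" using lam_pos by simp
  moreover have "ln (lam5 ^ 2) = 2 * ln lam5" "ln ((2::real) ^ 5) = 5 * ln 2"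
    using lam_pos by (simp_all only: ln_realpow of_nat_numeral zero_less_numeral)
  ultimately have "2 * ln lam5 < 5 * ln 2" by (simp only:)
  moreover have "5 * v - 4 * w < 5 * (u / 2 + v - w)" if "2 * w < 5 * u" for u v w :: real
    using that by simp
  ultimately have "5 * ln lam4 - 4 * ln lam5 < 5 * growth_gap"
    unfolding growth_gap_def sqrt2 by blast
  then have "kappa2 * growth_gap < 5 * growth_gap" by (simp only: kappa2_growth_gap)
  then show "kappa2 < 5" using growth_gap_pos by simp
qed

text \<open>The logarithm of the weight is affine in \<open>n\<close>, and \<open>kappa2\<close> is
  the argument at which it meets the line \<open>n * ln (sqrt 2)\<close>.\<close>

lemma digit_weight_square:
  "(digit_weight n)\<^sup>2 = 2 ^ n * exp (- (2 * growth_gap * (real n - kappa2)))"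
proof -
  have "ln (digit_weight n) = 5 * ln lam4 - 4 * ln lam5 + real n * (ln lam5 - ln lam4)"
    using lam_pos by (simp add: digit_weight_def ln_mult ln_div ln_realpow)
  also have "\<dots> = real n * ln (sqrt 2) - growth_gap * (real n - kappa2)"
    using kappa2_growth_gap by (simp add: growth_gap_def algebra_simps)
  finally have "2 * ln (digit_weight n) = real n * ln 2 - 2 * growth_gap * (real n - kappa2)"
    by (simp add: ln_sqrt algebra_simps)
  then have "ln ((digit_weight n)\<^sup>2) = ln (2 ^ n * exp (- (2 * growth_gap * (real n - kappa2))))"
    using digit_weight_pos[of n] by (simp add: ln_realpow ln_mult)
  then show ?thesis using digit_weight_pos[of n] by (subst (asm) ln_inj_iff) auto
qed

section \<open>Digit excess and decay of the slope scale\<close>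

definition digit_excess :: "(nat \<Rightarrow> nat) \<Rightarrow> nat \<Rightarrow> real" where
  "digit_excess a t = real (digit_sum a t) - kappa2 * real t"

text \<open>Comparable to the mean slope over the cylinder of order \<open>t\<close>.\<close>

definition slope_scale :: "(nat \<Rightarrow> nat) \<Rightarrow> nat \<Rightarrow> real" where
  "slope_scale a t = (cf_den a t)\<^sup>2 / 2 ^ digit_sum a t"

lemma digit_excess_simps [simp]:
  "digit_excess a 0 = 0" "digit_excess a (Suc t) = digit_excess a t + (real (a (Suc t)) - kappa2)"
  by (simp_all add: digit_excess_def algebra_simps)

lemma digit_excess_constant:
  assumes "\<And>i. s < i \<Longrightarrow> i \<le> s + k \<Longrightarrow> a i = d"
  shows "digit_excess a (s + k) = digit_excess a s + (real d - kappa2) * real k"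
  using assms by (induction k) (simp_all add: algebra_simps)

context digits
begin

definition weight_product :: "nat \<Rightarrow> real" where
  "weight_product t = (\<Prod>i=1..t. digit_weight (a i))"

definition rel_potential :: "nat \<Rightarrow> real" where
  "rel_potential t = potential (cf_den a t) (cf_den_prev a t) / weight_product t"

lemma weight_product_simps [simp]:
  "weight_product 0 = 1" "weight_product (Suc t) = weight_product t * digit_weight (a (Suc t))"
  by (simp_all add: weight_product_def)

lemma weight_product_pos: "0 < weight_product t"
  by (simp add: weight_product_def prod_pos digit_weight_pos)

lemma weight_product_square:
  "(weight_product t)\<^sup>2 = 2 ^ digit_sum a t * exp (- (2 * growth_gap * digit_excess a t))"
proof (induction t)
  case (Suc t)
  have "exp (- (2 * growth_gap * digit_excess a (Suc t))) = exp (- (2 * growth_gap * digit_excess a t)) *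
      exp (- (2 * growth_gap * (real (a (Suc t)) - kappa2)))"
    by (simp add: mult_exp_exp algebra_simps)
  then show ?case
    using Suc by (simp only: weight_product_simps digit_sum_simps power_mult_distrib digit_weight_square power_add mult_ac)
qed simp

lemma slope_scale_eq:
  "slope_scale a t = (cf_den a t / weight_product t)\<^sup>2 * exp (- (2 * growth_gap * digit_excess a t))"
proof -
  have "slope_scale a t * (weight_product t)\<^sup>2 =
      (cf_den a t)\<^sup>2 * exp (- (2 * growth_gap * digit_excess a t))"
    by (simp add: weight_product_square slope_scale_def)
  then show ?thesis using weight_product_pos[of t] by (simp add: field_simps power_divide)
qed

lemma rel_potential_Suc_le:
  assumes "potential (real (a (Suc t)) * cf_den a t + cf_den_prev a t) (cf_den a t)
    \<le> c * (digit_weight (a (Suc t)) * potential (cf_den a t) (cf_den_prev a t))"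
  shows "rel_potential (Suc t) \<le> c * rel_potential t"
  using divide_right_mono[OF assms, of "weight_product (Suc t)"] weight_product_pos[of t]
    digit_weight_pos[of "a (Suc t)"]
  by (simp add: rel_potential_def)

lemma rel_potential_decseq: "decseq rel_potential"
proof (rule decseq_SucI)
  fix t
  show "rel_potential (Suc t) \<le> rel_potential t"
    using rel_potential_Suc_le[of t 1] potential_nonincreasing[OF cf_den_pos cf_den_prev_nonneg cf_den_prev_le] a_pos[of t]
    by simp
qed

lemma rel_potential_ge: "cf_den a t / weight_product t \<le> rel_potential t"
  unfolding rel_potential_def using weight_product_pos[of t]
  by (intro divide_right_mono potential_bounds cf_den_prev_nonneg cf_den_prev_le) auto

lemma rel_potential_pos: "0 < rel_potential t"
  using rel_potential_ge[of t] cf_den_pos[of t] weight_product_pos[of t] 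
  by (meson divide_pos_pos less_le_trans)

lemma slope_scale_le:
  "slope_scale a t \<le> (rel_potential t)\<^sup>2 * exp (- (2 * growth_gap * digit_excess a t))"
  unfolding slope_scale_eq
  using rel_potential_ge[of t] cf_den_pos[of t] weight_product_pos[of t]
  by (intro mult_right_mono power_mono) auto

lemma slope_scale_nonneg: "0 \<le> slope_scale a t"
  by (simp add: slope_scale_def)

text \<open>A positive limit allows only finitely many losses of the factor 0.9999. Eventually only
  4 and 5 occur and no 5 follows a 4, which makes the digits constant.\<close>

lemma rel_potential_limit_pos_constant:
  assumes "rel_potential \<longlonglongrightarrow> L" "0 < L"
  shows "\<exists>s. (\<forall>i>s. a i = 4) \<or> (\<forall>i>s. a i = 5)"
proof -
  \<comment> \<open>Below \<open>L / 0.9999\<close> one more contraction would push the sequence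
    under its limit.\<close>
  have "L < L / 0.9999" using assms by simp
  then have "\<forall>\<^sub>F t in sequentially. rel_potential t < L / 0.9999"
    using assms by (intro order_tendstoD)
  then obtain T where T: "\<And>t. T \<le> t \<Longrightarrow> rel_potential t < L / 0.9999"
    by (auto simp: eventually_sequentially)
  have gt: "0.9999 * rel_potential t < rel_potential (Suc t)" if "T \<le> t" for t
  proof -
    have "L \<le> rel_potential (Suc t)" using decseq_ge[OF rel_potential_decseq assms(1)] .
    then show ?thesis using T[OF that] by simp
  qed
  note q = cf_den_pos cf_den_prev_nonneg cf_den_prev_le
  have 45: "a (Suc t) = 4 \<or> a (Suc t) = 5" if "T \<le> t" for t
  proof (rule ccontr)
    assume "\<not> (a (Suc t) = 4 \<or> a (Suc t) = 5)"
    then have "rel_potential (Suc t) \<le> 0.9999 * rel_potential t"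
      using a_pos[of t] by (intro rel_potential_Suc_le potential_contracts q) auto
    then show False using gt[OF that] by simp
  qed
  have n45: "a (Suc (Suc (Suc t))) = 4" if t: "T \<le> t" and 4: "a (Suc (Suc t)) = 4" for t
  proof (rule ccontr)
    assume "a (Suc (Suc (Suc t))) \<noteq> 4"
    then have 5: "a (Suc (Suc (Suc t))) = 5" using 45[of "Suc (Suc t)"] t by auto
    \<comment> \<open>The digit before the 4 is 4 or 5 as well, which yields the ratio 17/4 required
      by \<open>potential_5_after_4\<close>.\<close>
    have "4 \<le> real (a (Suc t))" using 45[OF t] by auto
    then have "4 * cf_den a t \<le> real (a (Suc t)) * cf_den a t" using q(1)[of t] by (intro mult_right_mono) auto
    then have "4 * cf_den a t \<le> cf_den a (Suc t)" using q(2)[of t] by simp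
    moreover have "cf_den a (Suc (Suc t)) = 4 * cf_den a (Suc t) + cf_den a t"
      unfolding cf_den.simps(2)[of a "Suc t"] cf_den_prev.simps 4 by simp
    ultimately have "4 * cf_den a (Suc (Suc t)) \<le> 17 * cf_den_prev a (Suc (Suc t))"
      unfolding cf_den_prev.simps by linarith
    then have "rel_potential (Suc (Suc (Suc t))) \<le> 0.9999 * rel_potential (Suc (Suc t))"
      using potential_5_after_4[OF q(1,3)[of "Suc (Suc t)"]]
      by (intro rel_potential_Suc_le) (simp only: 5 of_nat_numeral)
    then show False using gt[of "Suc (Suc t)"] t by simp
  qed
  show ?thesis
  proof (cases "\<forall>i>Suc T. a i = 5")
    case True
    then show ?thesis by (intro exI[of _ "Suc T"] disjI2)
  next
    case False
    then obtain i where i: "Suc T < i" "a i \<noteq> 5" by blast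
    define m where "m = i - 2"
    have m: "i = Suc (Suc m)" "T \<le> m" using i by (auto simp: m_def)
    have *: "a (Suc (Suc (m + k))) = 4" for k
    proof (induction k)
      case 0
      then show ?case using 45[of "Suc m"] i(2) m by simp
    next
      case (Suc k)
      then show ?case using n45[of "m + k"] m(2) by simp
    qed
    have "a j = 4" if "Suc m < j" for j
    proof -
      have "j = Suc (Suc (m + (j - Suc (Suc m))))" using that by simp
      then show ?thesis using *[of "j - Suc (Suc m)"] by (simp only:)
    qed
    then show ?thesis by (intro exI[of _ "Suc m"] disjI1 allI impI)
  qed
qed

text \<open>If \<open>rel_potential\<close> tends to 0, it is multiplied by a bounded exponential.
  Otherwise the digits are eventually constant: the bound by \<open>C\<close> excludes 4, and for 5
  the exponential itself vanishes.\<close>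

lemma slope_scale_tendsto_0:
  assumes C: "\<And>t. 1 \<le> t \<Longrightarrow> - C \<le> digit_excess a t"
  shows "slope_scale a \<longlonglongrightarrow> 0"
proof -
  obtain L where L: "rel_potential \<longlonglongrightarrow> L"
    by (rule decseq_convergent[OF rel_potential_decseq, of 0])
       (use rel_potential_pos in \<open>auto intro: less_imp_le\<close>)
  have "0 \<le> L"
    using LIMSEQ_le_const[OF L, of 0] less_imp_le[OF rel_potential_pos] by simp
  show ?thesis
  proof (cases "L = 0")
    case True
    have "(\<lambda>t. (rel_potential t)\<^sup>2 * exp (2 * growth_gap * C)) \<longlonglongrightarrow> 0\<^sup>2 * exp (2 * growth_gap * C)"
      using L True by (intro tendsto_intros) simp
    then have lim: "(\<lambda>t. (rel_potential t)\<^sup>2 * exp (2 * growth_gap * C)) \<longlonglongrightarrow> 0" by simp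
    have "slope_scale a t \<le> (rel_potential t)\<^sup>2 * exp (2 * growth_gap * C)" if "1 \<le> t" for t
    proof -
      have "growth_gap * - C \<le> growth_gap * digit_excess a t"
        using C[OF that] growth_gap_pos by (intro mult_left_mono) auto
      then show ?thesis
        using slope_scale_le[of t] by (elim order_trans) (auto intro!: mult_left_mono simp: mult.commute)
    qed
    then have le: "\<forall>\<^sub>F t in sequentially. slope_scale a t \<le> (rel_potential t)\<^sup>2 * exp (2 * growth_gap * C)"
      by (intro eventually_sequentiallyI[of 1])
    show ?thesis
      by (rule tendsto_sandwich[OF always_eventually[OF allI[OF slope_scale_nonneg]] le tendsto_const lim])
  next
    case False
    then obtain s where s: "(\<forall>i>s. a i = 4) \<or> (\<forall>i>s. a i = 5)"
      using rel_potential_limit_pos_constant[OF L] \<open>0 \<le> L\<close> by auto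
    from s have five: "\<forall>i>s. a i = 5"
    proof
      assume "\<forall>i>s. a i = 4"
      then have e: "digit_excess a (s + k) = digit_excess a s - (kappa2 - 4) * real k" for k
        using digit_excess_constant[of s k a 4] by (simp add: algebra_simps)
      obtain k where k: "(digit_excess a s + C) / (kappa2 - 4) < real k" using reals_Archimedean2 by blast
      then have "digit_excess a s + C < (kappa2 - 4) * real k" using kappa2_gt_4 by (simp add: field_simps)
      \<comment> \<open>Passing to \<open>Suc k\<close> makes the index positive, as the hypothesis
        on \<open>C\<close> requires.\<close>
      moreover have "(kappa2 - 4) * real k \<le> (kappa2 - 4) * real (Suc k)"
        using kappa2_gt_4 by (intro mult_left_mono) auto
      ultimately show ?thesis using C[of "s + Suc k"] e[of "Suc k"] by linarith
    qed
    then have e: "digit_excess a (k + s) = digit_excess a s + (5 - kappa2) * real k" for k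
      using digit_excess_constant[of s k a 5] by (simp add: add.commute)
    let ?g = "\<lambda>k::nat. (rel_potential 0)\<^sup>2 * exp (- (2 * growth_gap * (digit_excess a s + (5 - kappa2) * real k)))"
    have le: "slope_scale a (k + s) \<le> ?g k" for k
    proof -
      have "(rel_potential (k + s))\<^sup>2 \<le> (rel_potential 0)\<^sup>2"
        using decseqD[OF rel_potential_decseq, of 0 "k + s"] rel_potential_pos[of "k + s"]
        by (intro power_mono) auto
      then show ?thesis
        unfolding e[symmetric] using slope_scale_le[of "k + s"] by (elim order_trans) (intro mult_right_mono, auto)
    qed
    have lim: "?g \<longlonglongrightarrow> 0"
    proof -
      have c: "0 < 2 * growth_gap * (5 - kappa2)" using growth_gap_pos kappa2_lt_5 by simp
      have "?g k = (rel_potential 0)\<^sup>2 * exp (- (2 * growth_gap * digit_excess a s)) *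
          exp (- (2 * growth_gap * (5 - kappa2)) * real k)" for k
        by (simp add: mult_exp_exp algebra_simps)
      moreover have "(\<lambda>k::nat. A * exp (- B * real k)) \<longlonglongrightarrow> 0" if "0 < B" for A B :: real
        using that by real_asymp
      ultimately show ?thesis using c by (simp only:)
    qed
    have "(\<lambda>k. slope_scale a (k + s)) \<longlonglongrightarrow> 0"
      by (rule tendsto_sandwich[OF always_eventually[OF allI[OF slope_scale_nonneg]]
            always_eventually[OF allI[OF le]] tendsto_const lim])
    then show ?thesis by (rule LIMSEQ_offset)
  qed
qed

end

section \<open>Vanishing derivative\<close>

lemma question_mark_near_integer:
  assumes "e = 0 \<or> e = 1" "0 \<le> v" "v \<le> 1"
  shows "\<bar>question_mark v - question_mark e\<bar> \<le> 2 * \<bar>v - e\<bar>"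
  using assms question_mark_upper(1)[of v] question_mark_lower[of v] question_mark_bounds[of v] by auto

context digits
begin

text \<open>Going into the cylinder divides values by exactly \<open>2 ^ digit_sum a t\<close> and
  distances by at most \<open>4 * (cf_den a t)\<^sup>2\<close>.\<close>

lemma question_mark_cf_app_le:
  assumes "0 \<le> u" "u \<le> 1" "0 \<le> v" "v \<le> 1"
    and "\<bar>question_mark u - question_mark v\<bar> \<le> c * \<bar>u - v\<bar>" "0 \<le> c"
  shows "\<bar>question_mark (cf_app a t u) - question_mark (cf_app a t v)\<bar>
    \<le> 4 * c * slope_scale a t * \<bar>cf_app a t u - cf_app a t v\<bar>"
proof -
  have "\<bar>u - v\<bar> \<le> 4 * (cf_den a t)\<^sup>2 * \<bar>cf_app a t u - cf_app a t v\<bar>"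
    using cf_app_dist_bounds(1)[OF assms(1-4), of t] cf_den_pos[of t] by (simp add: field_simps)
  then have "c * \<bar>u - v\<bar> \<le> c * (4 * (cf_den a t)\<^sup>2 * \<bar>cf_app a t u - cf_app a t v\<bar>)"
    using assms by (intro mult_left_mono) auto
  then have "\<bar>question_mark u - question_mark v\<bar> / 2 ^ digit_sum a t
      \<le> c * (4 * (cf_den a t)\<^sup>2 * \<bar>cf_app a t u - cf_app a t v\<bar>) / 2 ^ digit_sum a t"
    using assms by (intro divide_right_mono) auto
  then show ?thesis
    unfolding question_mark_cf_app_dist[OF assms(1-4)] by (simp add: slope_scale_def mult_ac)
qed

text \<open>A boundary point of the cylinder of order \<open>t + 1\<close> separates the two points; the chord is
  cut there, since on either side of a rational point the slope is under control.\<close>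

lemma question_mark_slope_le:
  assumes y: "0 < y" "y < 1" and u: "0 \<le> u" "u \<le> 1"
    and x: "x = cf_app a (Suc t) y" and z: "z = cf_app a t u" and out: "z \<notin> cf_app a (Suc t) ` {0..1}"
  shows "\<bar>question_mark z - question_mark x\<bar>
    \<le> 160 * (slope_scale a t + slope_scale a (Suc t)) * \<bar>z - x\<bar>"
proof -
  let ?n = "a (Suc t)"
  let ?F = "cf_app a t"
  define y0 where "y0 = 1 / (real ?n + y)"
  have y0: "0 \<le> y0" "y0 \<le> 1" using inverse_digit_bounds[of y t] y by (simp_all add: y0_def)
  have xF: "x = ?F y0" by (simp add: x y0_def)
  have n: "1 \<le> ?n" "1 \<le> real ?n" using a_pos[of t] by auto
  have lt: "1 / (real ?n + 1) < y0" "y0 < 1 / real ?n"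
    using y n by (auto simp: y0_def field_simps)
  have "u < 1 / (real ?n + 1) \<or> 1 / real ?n < u"
  proof (rule ccontr)
    assume "\<not> ?thesis"
    then have b: "1 / (real ?n + 1) \<le> u" "u \<le> 1 / real ?n" by auto
    then have "0 < u" using n by (smt (verit) zero_less_divide_1_iff)
    then have "0 \<le> 1 / u - real ?n" "1 / u - real ?n \<le> 1" using b n by (auto simp: field_simps)
    moreover have "z = cf_app a (Suc t) (1 / u - real ?n)" using z \<open>0 < u\<close> by simp
    ultimately show False using out by (metis atLeastAtMost_iff image_eqI)
  qed
  \<comment> \<open>The cut is the end of the inner cylinder that faces \<open>u\<close>. As a tail
    of order \<open>t\<close> it is a unit fraction, as a tail of order \<open>t + 1\<close> it is
    the integer \<open>e\<close>, so both slope bounds apply there.\<close>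
  then obtain e :: nat where e: "e = 0 \<or> e = 1"
    and sep: "\<bar>u - 1 / (real ?n + real e)\<bar> \<le> \<bar>u - y0\<bar>" "\<bar>1 / (real ?n + real e) - y0\<bar> \<le> \<bar>u - y0\<bar>"
  proof
    assume "u < 1 / (real ?n + 1)"
    then show thesis using that[of 1] lt by auto
  next
    assume "1 / real ?n < u"
    then show thesis using that[of 0] lt by auto
  qed
  define w where "w = 1 / real (?n + e)"
  have w: "0 \<le> w" "w \<le> 1" "w = 1 / (real ?n + real e)" using n by (auto simp: w_def field_simps)
  have Fw: "?F w = cf_app a (Suc t) (real e)" by (simp add: w)
  \<comment> \<open>The factor 4 is the distortion of \<open>cf_app a t\<close>; with the slope
    bound 10 it gives 160 = 4 * 10 * 4.\<close>
  have near: "\<bar>?F v - ?F v'\<bar> \<le> 4 * \<bar>z - x\<bar>"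
    if "0 \<le> v" "v \<le> 1" "0 \<le> v'" "v' \<le> 1" "\<bar>v - v'\<bar> \<le> \<bar>u - y0\<bar>" for v v'
  proof -
    have "\<bar>?F v - ?F v'\<bar> \<le> \<bar>v - v'\<bar> / (cf_den a t)\<^sup>2" using that by (intro cf_app_dist_bounds(2)) auto
    also have "\<dots> \<le> 4 * (\<bar>u - y0\<bar> / (4 * (cf_den a t)\<^sup>2))" using that(5) by (simp add: divide_right_mono)
    also have "\<dots> \<le> 4 * \<bar>z - x\<bar>"
      unfolding z xF using u y0 by (intro mult_left_mono cf_app_dist_bounds(1)) auto
    finally show ?thesis .
  qed
  have "\<bar>question_mark (?F u) - question_mark (?F w)\<bar> \<le> 4 * 10 * slope_scale a t * \<bar>?F u - ?F w\<bar>"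
    using question_mark_near_unit_fraction[of "?n + e" u] n u w
    by (intro question_mark_cf_app_le) (auto simp: w_def)
  also have "\<dots> \<le> 4 * 10 * slope_scale a t * (4 * \<bar>z - x\<bar>)"
    using near[of u w] u w sep slope_scale_nonneg[of t] by (intro mult_left_mono) auto
  finally have 1: "\<bar>question_mark z - question_mark (?F w)\<bar> \<le> 160 * slope_scale a t * \<bar>z - x\<bar>"
    by (simp add: z)
  have "\<bar>question_mark (cf_app a (Suc t) y) - question_mark (cf_app a (Suc t) (real e))\<bar>
      \<le> 4 * 2 * slope_scale a (Suc t) * \<bar>cf_app a (Suc t) y - cf_app a (Suc t) (real e)\<bar>"
    using question_mark_near_integer[of "real e" y] e y
    by (intro question_mark_cf_app_le) auto
  then have "\<bar>question_mark x - question_mark (?F w)\<bar> \<le> 4 * 2 * slope_scale a (Suc t) * \<bar>?F w - x\<bar>"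
    by (simp only: x[symmetric] Fw[symmetric] abs_minus_commute[of x])
  also have "\<dots> \<le> 4 * 2 * slope_scale a (Suc t) * (4 * \<bar>z - x\<bar>)"
    using near[of w y0] y0 w sep slope_scale_nonneg[of "Suc t"] unfolding xF by (intro mult_left_mono) auto
  also have "\<dots> \<le> 160 * slope_scale a (Suc t) * \<bar>z - x\<bar>"
    using mult_nonneg_nonneg[OF slope_scale_nonneg[of "Suc t"], of "\<bar>z - x\<bar>"] by (simp add: mult.commute)
  finally have "\<bar>question_mark x - question_mark (?F w)\<bar> \<le> 160 * slope_scale a (Suc t) * \<bar>z - x\<bar>" .
  with 1 show ?thesis unfolding distrib_left distrib_right by linarith
qed

text \<open>Invariance of domain, applied to a continuous injection on the open interval.\<close>

lemma cf_app_image_neighbourhood: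
  assumes "0 < y" "y < 1"
  shows "\<exists>e>0. \<forall>z. \<bar>z - cf_app a t y\<bar> < e \<longrightarrow> z \<in> cf_app a t ` {0..1}"
proof -
  have "open (cf_app a t ` {0<..<1})"
    using continuous_on_subset[OF continuous_on_cf_app] inj_on_subset[OF inj_on_cf_app]
    by (intro invariance_of_domain) (auto simp: subset_iff)
  then obtain e where "0 < e" "ball (cf_app a t y) e \<subseteq> cf_app a t ` {0<..<1}"
    using assms unfolding open_contains_ball by (metis greaterThanLessThan_iff image_eqI)
  then show ?thesis
    by (intro exI[of _ e]) (auto simp: subset_iff dist_real_def abs_minus_commute)
qed

text \<open>The widths of the cylinders tend to 0, so a point other than \<open>x\<close> leaves
  them at some order.\<close>

lemma last_cylinder:
  assumes x: "\<And>t. x \<in> cf_app a t ` {0..1}" and z: "z \<in> cf_app a T ` {0..1}" "z \<noteq> x"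
  shows "\<exists>t\<ge>T. z \<in> cf_app a t ` {0..1} \<and> z \<notin> cf_app a (Suc t) ` {0..1}"
proof (rule ccontr)
  assume "\<not> ?thesis"
  then have step: "z \<in> cf_app a (Suc t) ` {0..1}" if "T \<le> t" "z \<in> cf_app a t ` {0..1}" for t
    using that by blast
  have all: "z \<in> cf_app a t ` {0..1}" if "T \<le> t" for t
    using that by (induction t rule: dec_induct) (use z step in auto)
  have "\<bar>z - x\<bar> \<le> 1 / (cf_den a t)\<^sup>2" if t: "T \<le> t" for t
  proof -
    obtain v w where vw: "v \<in> {0..1}" "w \<in> {0..1}" "z = cf_app a t v" "x = cf_app a t w"
      using all[OF t] x[of t] by blast
    then have "\<bar>z - x\<bar> \<le> \<bar>v - w\<bar> / (cf_den a t)\<^sup>2" using cf_app_dist_bounds(2)[of v w t] by simp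
    also have "\<dots> \<le> 1 / (cf_den a t)\<^sup>2" using vw by (intro divide_right_mono) auto
    finally show ?thesis .
  qed
  then have "\<bar>z - x\<bar> \<le> 0"
    by (intro LIMSEQ_le_const[OF inverse_cf_den_square_tendsto_0]) blast
  then show False using z by simp
qed

lemma has_ext_derivative_0:
  assumes x: "\<And>t. x = cf_app a t (r t)" and r: "\<And>t. 0 < r t \<and> r t < 1"
    and lim: "slope_scale a \<longlonglongrightarrow> 0"
  shows "has_ext_derivative question_mark 0 x"
proof -
  have "((\<lambda>\<delta>. (question_mark (x + \<delta>) - question_mark x) / \<delta>) \<longlongrightarrow> 0) (at 0)"
  proof (rule tendstoI)
    fix \<epsilon> :: real assume \<epsilon>: "0 < \<epsilon>"
    \<comment> \<open>Two consecutive slope scales enter \<open>question_mark_slope_le\<close>, each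
      with factor 160.\<close>
    have "\<forall>\<^sub>F t in sequentially. slope_scale a t < \<epsilon> / 320"
      using \<epsilon> by (intro order_tendstoD[OF lim]) auto
    then obtain T where T: "\<And>t. T \<le> t \<Longrightarrow> slope_scale a t < \<epsilon> / 320"
      by (auto simp: eventually_sequentially)
    obtain d where d: "0 < d" "\<And>z. \<bar>z - x\<bar> < d \<Longrightarrow> z \<in> cf_app a T ` {0..1}"
      using cf_app_image_neighbourhood[of "r T" T] r x[of T] by metis
    have "\<bar>(question_mark (x + \<delta>) - question_mark x) / \<delta>\<bar> < \<epsilon>" if \<delta>: "\<delta> \<noteq> 0" "\<bar>\<delta>\<bar> < d" for \<delta>
    proof -
      have "x \<in> cf_app a t ` {0..1}" for t using x[of t] r[of t] by (intro image_eqI[of _ _ "r t"]) auto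
      then obtain t where t: "T \<le> t" "x + \<delta> \<in> cf_app a t ` {0..1}" "x + \<delta> \<notin> cf_app a (Suc t) ` {0..1}"
        using last_cylinder[of x "x + \<delta>" T] d(2)[of "x + \<delta>"] \<delta> by auto
      then obtain u where "u \<in> {0..1}" "x + \<delta> = cf_app a t u" by blast
      then have "\<bar>question_mark (x + \<delta>) - question_mark x\<bar>
          \<le> 160 * (slope_scale a t + slope_scale a (Suc t)) * \<bar>(x + \<delta>) - x\<bar>"
        using t(3) r[of "Suc t"] x[of "Suc t"] by (intro question_mark_slope_le[of "r (Suc t)" u]) auto
      also have "\<dots> < \<epsilon> * \<bar>\<delta>\<bar>"
        using T[OF t(1)] T[of "Suc t"] t(1) \<delta> by simp
      finally show ?thesis using \<delta> by (simp add: abs_divide divide_less_eq)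
    qed
    then show "\<forall>\<^sub>F \<delta> in at 0. dist ((question_mark (x + \<delta>) - question_mark x) / \<delta>) 0 < \<epsilon>"
      using d(1) by (auto simp: eventually_at dist_real_def)
  qed
  then show ?thesis unfolding has_ext_derivative_def by (simp add: zero_ereal_def)
qed

end

lemma cf_app_cf_rem:
  assumes "x \<notin> \<rat>" "0 < x" "x < 1"
  shows "cf_app (partial_quotient x) t (cf_rem x t) = x"
  by (induction t) (simp_all only: cf_app.simps cf_rem.simps(1) flip: cf_rem_step(2)[OF assms])

lemma pq_sum_eq_digit_sum: "pq_sum x = digit_sum (partial_quotient x)"
  by (simp add: pq_sum_def digit_sum_def fun_eq_iff)

lemma question_mark_derivative_0:
  assumes x: "0 < x" "x < 1" "x \<notin> \<rat>"
    and C: "\<And>t. 1 \<le> t \<Longrightarrow> kappa2 * real t - C \<le> real (pq_sum x t)"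
  shows "has_ext_derivative question_mark 0 x"
proof -
  interpret digits "partial_quotient x" by unfold_locales (rule cf_rem_step[OF x(3,1,2)])
  show ?thesis
  proof (rule has_ext_derivative_0)
    show "x = cf_app (partial_quotient x) t (cf_rem x t)" for t
      using cf_app_cf_rem[OF x(3,1,2)] by simp
    show "0 < cf_rem x t \<and> cf_rem x t < 1" for t
      using cf_rem_irrational[OF x(3,1,2)] by blast
    show "slope_scale (partial_quotient x) \<longlonglongrightarrow> 0"
    proof (rule slope_scale_tendsto_0[of C])
      show "- C \<le> digit_excess (partial_quotient x) t" if "1 \<le> t" for t
        using C[OF that] by (simp add: digit_excess_def pq_sum_eq_digit_sum)
    qed
  qed
qed

section \<open>Missing derivative\<close>

context digits
begin

text \<open>Nested compact cylinders have a common point. Injectivity of \<open>cf_app\<close> makes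
  its tails satisfy the Gauss recursion, so the digits reappear as floors.\<close>

lemma exists_real_with_digits:
  obtains x r where "0 < x" "x < 1" "x \<notin> \<rat>" "\<And>t. x = cf_app a t (r t)" "\<And>t. 0 < r t \<and> r t < 1"
    "\<And>t. pq_sum x t = digit_sum a t"
proof -
  have sub: "cf_app a (Suc t) ` {0..1} \<subseteq> cf_app a t ` {0..1}" for t
  proof
    fix z assume "z \<in> cf_app a (Suc t) ` {0..1}"
    then obtain y where "y \<in> {0..1}" "z = cf_app a t (1 / (real (a (Suc t)) + y))" by auto
    then show "z \<in> cf_app a t ` {0..1}"
      using inverse_digit_bounds[of y t] by (intro image_eqI[of _ _ "1 / (real (a (Suc t)) + y)"]) auto
  qed
  have "(\<Inter>t. cf_app a t ` {0..1}) \<noteq> {}"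
  proof (rule compact_nest)
    show "compact (cf_app a t ` {0..1})" for t
      by (intro compact_continuous_image continuous_on_cf_app compact_Icc)
    show "cf_app a t ` {0..1} \<subseteq> cf_app a s ` {0..1}" if "s \<le> t" for s t
      by (rule decseqD[OF decseq_SucI that]) (rule sub)
  qed auto
  then obtain x where "\<forall>t. x \<in> cf_app a t ` {0..1}" by auto
  then have "\<forall>t. \<exists>y. y \<in> {0..1} \<and> x = cf_app a t y" by blast
  then obtain r where r: "\<And>t. r t \<in> {0..1}" "\<And>t. x = cf_app a t (r t)" by metis
  have step: "r t = 1 / (real (a (Suc t)) + r (Suc t))" for t
  proof (rule inj_onD[OF inj_on_cf_app[of t]])
    show "cf_app a t (r t) = cf_app a t (1 / (real (a (Suc t)) + r (Suc t)))"
      using r(2)[of t] r(2)[of "Suc t"] by simp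
    show "1 / (real (a (Suc t)) + r (Suc t)) \<in> {0..1}"
      using r(1)[of "Suc t"] inverse_digit_bounds[of "r (Suc t)" t] by simp
  qed (rule r)
  have pos: "0 < r t" for t
    unfolding step[of t] using a_ge_1[of t] r(1)[of "Suc t"] by simp
  have lt1: "r t < 1" for t
    unfolding step[of t] using a_ge_1[of t] pos[of "Suc t"] by (simp add: field_simps)
  have inv: "1 / r t = real (a (Suc t)) + r (Suc t)" for t
    unfolding step[of t] by simp
  have fl: "\<lfloor>1 / r t\<rfloor> = int (a (Suc t))" for t
    unfolding inv using pos[of "Suc t"] lt1[of "Suc t"] by (simp add: floor_unique)
  have rem: "cf_rem x t = r t" for t
  proof (induction t)
    case 0
    then show ?case using r(2)[of 0] by simp
  next
    case (Suc t)
    moreover have "frac (1 / r t) = r (Suc t)" unfolding frac_def fl by (simp add: inv)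
    ultimately show ?case by simp
  qed
  have "partial_quotient x (Suc t) = a (Suc t)" for t
    by (simp add: partial_quotient_def rem fl)
  then have sum: "pq_sum x t = digit_sum a t" for t
    unfolding pq_sum_eq_digit_sum by (induction t) simp_all
  \<comment> \<open>Infinite descent: a tail p/q is followed by a tail with the smaller denominator
    p.\<close>
  have irr: "r t \<noteq> of_int p / real q" if "0 < q" for p q t
    using that
  proof (induction q arbitrary: p t rule: less_induct)
    case (less q)
    show ?case
    proof
      assume e: "r t = of_int p / real q"
      have "0 < p" "p < int q"
        using pos[of t] lt1[of t] less.prems unfolding e by (auto simp: zero_less_divide_iff divide_less_eq)
      then obtain p' where p': "p = int p'" "0 < p'" "p' < q" by (metis of_nat_less_iff zero_less_imp_eq_int)
      have "r (Suc t) = real q / real p' - real (a (Suc t))" using inv[of t] e p' by simp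
      also have "\<dots> = of_int (int q - int (a (Suc t)) * int p') / real p'" using p' by (simp add: field_simps)
      finally show False using less.IH[OF p'(3,2)] by blast
    qed
  qed
  have "x \<notin> \<rat>"
  proof
    assume "x \<in> \<rat>"
    then obtain i n where "x = of_int i / real n" "n \<noteq> 0" by (auto simp: Rats_eq_int_div_nat)
    then show False using irr[of n 0 i] r(2)[of 0] by simp
  qed
  then show thesis
    using that[of x r] pos lt1 sum r(2) pos[of 0] lt1[of 0] r(2)[of 0] by simp
qed

text \<open>Since 1/2 is fixed by the monotone \<open>question_mark\<close>, the endpoint across 1/2
  from \<open>r\<close> is at least 1/2 away both before and after applying it. The chord to that
  end of the cylinder has the required slope.\<close>

lemma chord_slope:
  assumes r: "0 < r" "r < 1" and x: "x = cf_app a t r"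
  shows "\<exists>\<delta>. \<delta> \<noteq> 0 \<and> \<bar>\<delta>\<bar> \<le> 1 / (cf_den a t)\<^sup>2 \<and>
    slope_scale a t / 2 \<le> (question_mark (x + \<delta>) - question_mark x) / \<delta> \<and>
    (question_mark (x + \<delta>) - question_mark x) / \<delta> \<le> 8 * slope_scale a t"
proof -
  have half: "question_mark (1/2) = 1/2" using question_mark_unit_fraction[of 2] by simp
  have qr: "0 \<le> question_mark r" "question_mark r \<le> 1" using question_mark_bounds[of r] r by auto
  obtain u :: real where u: "u = 0 \<or> u = 1" "1/2 \<le> \<bar>u - r\<bar>" "1/2 \<le> \<bar>question_mark u - question_mark r\<bar>"
  proof (cases "1/2 \<le> r")
    case True
    then have "1/2 \<le> question_mark r"
      using mono_onD[OF question_mark_mono, of "1/2" r] r half by simp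
    then show thesis using that[of 0] True qr by simp
  next
    case False
    then have "question_mark r \<le> 1/2"
      using mono_onD[OF question_mark_mono, of r "1/2"] r half by simp
    then show thesis using that[of 1] False qr by simp
  qed
  have u01: "0 \<le> u" "u \<le> 1" "\<bar>u - r\<bar> \<le> 1" "\<bar>question_mark u - question_mark r\<bar> \<le> 1"
    using u(1) r qr by auto
  define z where "z = cf_app a t u"
  define Q where "Q = (cf_den a t)\<^sup>2"
  define D where "D = \<bar>question_mark u - question_mark r\<bar>"
  have Q: "0 < Q" using cf_den_pos[of t] by (simp add: Q_def)
  have "\<bar>u - r\<bar> / (4 * Q) \<le> \<bar>z - x\<bar>" "\<bar>z - x\<bar> \<le> \<bar>u - r\<bar> / Q"
    using cf_app_dist_bounds[of u r t] u01 r by (auto simp: z_def x Q_def)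
  moreover have "1 / (8 * Q) \<le> \<bar>u - r\<bar> / (4 * Q)" "\<bar>u - r\<bar> / Q \<le> 1 / Q"
    using u u01 Q by (auto simp: field_simps)
  ultimately have d: "1 / (8 * Q) \<le> \<bar>z - x\<bar>" "\<bar>z - x\<bar> \<le> 1 / Q" by linarith+
  have nz: "0 < \<bar>z - x\<bar>" using d(1) Q by (smt (verit) zero_less_divide_1_iff)
  have z01: "z \<in> {0..1}" "x \<in> {0..1}" using cf_app_bounds[of _ t] u01 r by (auto simp: z_def x)
  have "0 \<le> (question_mark z - question_mark x) / (z - x)"
    using mono_onD[OF question_mark_mono, of z x] mono_onD[OF question_mark_mono, of x z] z01
    by (cases "z \<le> x") (auto intro: divide_nonpos_nonpos divide_nonneg_nonneg)
  then have "(question_mark z - question_mark x) / (z - x) = \<bar>question_mark z - question_mark x\<bar> / \<bar>z - x\<bar>"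
    by (simp flip: abs_divide)
  also have "\<bar>question_mark z - question_mark x\<bar> = D / 2 ^ digit_sum a t"
    using question_mark_cf_app_dist[of u r t] u01 r by (simp add: z_def x D_def)
  finally have q: "(question_mark z - question_mark x) / (z - x) = D / 2 ^ digit_sum a t / \<bar>z - x\<bar>" .
  have "slope_scale a t / 2 = (1/2) / 2 ^ digit_sum a t / (1 / Q)" by (simp add: slope_scale_def Q_def)
  also have "\<dots> \<le> D / 2 ^ digit_sum a t / \<bar>z - x\<bar>"
    using d nz u(3) by (intro frac_le divide_right_mono divide_nonneg_nonneg) (auto simp: D_def)
  finally have lo: "slope_scale a t / 2 \<le> (question_mark z - question_mark x) / (z - x)" unfolding q .
  have "D / 2 ^ digit_sum a t / \<bar>z - x\<bar> \<le> 1 / 2 ^ digit_sum a t / (1 / (8 * Q))"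
    using d Q u01 by (intro frac_le divide_right_mono divide_nonneg_nonneg) (auto simp: D_def)
  also have "\<dots> = 8 * slope_scale a t" by (simp add: slope_scale_def Q_def)
  finally have hi: "(question_mark z - question_mark x) / (z - x) \<le> 8 * slope_scale a t" unfolding q .
  show ?thesis
    using nz d(2) lo hi by (intro exI[of _ "z - x"]) (auto simp: Q_def)
qed

text \<open>The chords of \<open>chord_slope\<close> shrink to \<open>x\<close>, so a limit would be
  0 along \<open>u\<close> and infinite along \<open>v\<close>.\<close>

lemma not_ext_derivative_exists:
  assumes x: "\<And>t. x = cf_app a t (r t)" and r: "\<And>t. 0 < r t \<and> r t < 1"
    and u: "filterlim u sequentially sequentially" "(\<lambda>k. slope_scale a (u k)) \<longlonglongrightarrow> 0"
    and v: "filterlim v sequentially sequentially" "filterlim (\<lambda>k. slope_scale a (v k)) at_top sequentially"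
  shows "\<not> ext_derivative_exists question_mark x"
proof
  assume "ext_derivative_exists question_mark x"
  then obtain L where L: "((\<lambda>\<delta>. ereal ((question_mark (x + \<delta>) - question_mark x) / \<delta>)) \<longlongrightarrow> L) (at 0)"
    unfolding ext_derivative_exists_def has_ext_derivative_def by blast
  define g where "g \<delta> = (question_mark (x + \<delta>) - question_mark x) / \<delta>" for \<delta>
  obtain d where d: "\<And>t. d t \<noteq> 0" "\<And>t. \<bar>d t\<bar> \<le> 1 / (cf_den a t)\<^sup>2"
      "\<And>t. slope_scale a t / 2 \<le> g (d t)" "\<And>t. g (d t) \<le> 8 * slope_scale a t"
    using chord_slope[OF conjunct1[OF r] conjunct2[OF r] x] unfolding g_def by metis
  have "d \<longlonglongrightarrow> 0"
    by (rule Lim_null_comparison[OF always_eventually inverse_cf_den_square_tendsto_0]) (simp add: d(2))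
  then have "filterlim d (at 0) sequentially"
    using d(1) by (intro filterlim_atI always_eventually) auto
  then have lim: "(\<lambda>t. ereal (g (d t))) \<longlonglongrightarrow> L"
    using filterlim_compose[OF L] unfolding g_def by blast
  have "(\<lambda>k. g (d (u k))) \<longlonglongrightarrow> 0"
  proof (rule tendsto_sandwich[OF always_eventually always_eventually tendsto_const])
    show "(\<lambda>k. 8 * slope_scale a (u k)) \<longlonglongrightarrow> 0" using tendsto_mult_left[OF u(2), of 8] by simp
    show "\<forall>k. 0 \<le> g (d (u k))"
      using d(3) slope_scale_nonneg by (meson divide_nonneg_nonneg order_trans zero_le_numeral)
  qed (use d(4) in blast)
  then have "(\<lambda>k. ereal (g (d (u k)))) \<longlonglongrightarrow> ereal 0" by simp
  moreover have "(\<lambda>k. ereal (g (d (u k)))) \<longlonglongrightarrow> L" by (rule filterlim_compose[OF lim u(1)])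
  ultimately have L0: "L = ereal 0" using LIMSEQ_unique by blast
  have "filterlim (\<lambda>k. 1/2 * slope_scale a (v k)) at_top sequentially"
    by (rule filterlim_tendsto_pos_mult_at_top[OF tendsto_const _ v(2)]) simp
  then have "filterlim (\<lambda>k. g (d (v k))) at_top sequentially"
    by (rule filterlim_at_top_mono) (use d(3) in \<open>simp add: always_eventually\<close>)
  then have "(\<lambda>k. ereal (g (d (v k)))) \<longlonglongrightarrow> \<infinity>" by (simp add: tendsto_PInfty_eq_at_top)
  moreover have "(\<lambda>k. ereal (g (d (v k)))) \<longlonglongrightarrow> L" by (rule filterlim_compose[OF lim v(1)])
  ultimately have "L = \<infinity>" using LIMSEQ_unique by blast
  with L0 show False by simp
qed

text \<open>The linear form \<open>F\<close> is an eigenvector of the digit \<open>d\<close>, so a whole run of equal digits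
  costs only one bounded factor, no matter how long it is.\<close>

lemma cf_den_block:
  assumes run: "\<And>i. s < i \<Longrightarrow> i \<le> s + k \<Longrightarrow> a i = d"
    and step: "\<And>q y. F (real d * q + y) q = digit_weight d * F q y"
    and bnd: "\<And>q y. 0 \<le> y \<Longrightarrow> y \<le> q \<Longrightarrow> c * q \<le> F q y \<and> F q y \<le> 2 * (c * q)" and c: "0 < c"
  shows "cf_den a s / weight_product s \<le> 2 * (cf_den a (s + k) / weight_product (s + k))"
proof -
  have eq: "F (cf_den a (s + k)) (cf_den_prev a (s + k)) / weight_product (s + k) =
      F (cf_den a s) (cf_den_prev a s) / weight_product s"
    using run
  proof (induction k)
    case (Suc k)
    have "a (Suc (s + k)) = d" using Suc.prems[of "Suc (s + k)"] by simp
    then have "F (cf_den a (s + Suc k)) (cf_den_prev a (s + Suc k)) / weight_product (s + Suc k) =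
        digit_weight d * F (cf_den a (s + k)) (cf_den_prev a (s + k)) / (weight_product (s + k) * digit_weight d)"
      by (simp add: step)
    also have "\<dots> = F (cf_den a (s + k)) (cf_den_prev a (s + k)) / weight_product (s + k)"
      using digit_weight_pos[of d] by simp
    also have "\<dots> = F (cf_den a s) (cf_den_prev a s) / weight_product s"
      using Suc.prems by (intro Suc.IH) auto
    finally show ?case .
  qed simp
  note b = bnd[OF cf_den_prev_nonneg cf_den_prev_le]
  have "c * (cf_den a s / weight_product s) \<le> F (cf_den a s) (cf_den_prev a s) / weight_product s"
    using divide_right_mono[OF conjunct1[OF b[of s]] less_imp_le[OF weight_product_pos[of s]]] by simp
  also have "\<dots> = F (cf_den a (s + k)) (cf_den_prev a (s + k)) / weight_product (s + k)" using eq by simp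
  also have "\<dots> \<le> c * (2 * (cf_den a (s + k) / weight_product (s + k)))"
    using divide_right_mono[OF conjunct2[OF b[of "s + k"]] less_imp_le[OF weight_product_pos[of "s + k"]]]
    by (simp add: mult_ac)
  finally show ?thesis using c by (simp only: mult_le_cancel_left_pos)
qed

lemma cf_den_block_4:
  assumes "\<And>i. s < i \<Longrightarrow> i \<le> s + k \<Longrightarrow> a i = 4"
  shows "cf_den a s / weight_product s \<le> 2 * (cf_den a (s + k) / weight_product (s + k))"
proof (rule cf_den_block[OF assms, where F = form4 and c = lam5])
  show "lam5 * q \<le> form4 q y \<and> form4 q y \<le> 2 * (lam5 * q)" if "0 \<le> y" "y \<le> q" for q y
  proof -
    have "0 \<le> (lam4 - 4) * y" "(lam4 - 4) * y \<le> 1 * q" using that lam4_approx mult_mono[of "lam4 - 4" 1 y q] by auto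
    then have "lam5 * q \<le> lam5 * (q + (lam4 - 4) * y)" "lam5 * (q + (lam4 - 4) * y) \<le> lam5 * (2 * q)"
      using lam_pos by (intro mult_left_mono; simp)+
    then show ?thesis by (simp add: form4_def)
  qed
qed (use lam_pos form4_step digit_weight_4 in auto)

lemma cf_den_block_5:
  assumes "\<And>i. s < i \<Longrightarrow> i \<le> s + k \<Longrightarrow> a i = 5"
  shows "cf_den a s / weight_product s \<le> 2 * (cf_den a (s + k) / weight_product (s + k))"
proof (rule cf_den_block[OF assms, where F = form5 and c = "lam4 + 1"])
  show "(lam4 + 1) * q \<le> form5 q y \<and> form5 q y \<le> 2 * ((lam4 + 1) * q)" if "0 \<le> y" "y \<le> q" for q y
  proof -
    have "0 \<le> (lam5 - 5) * y" "(lam5 - 5) * y \<le> 1 * q" using that lam5_approx mult_mono[of "lam5 - 5" 1 y q] by auto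
    then have "(lam4 + 1) * q \<le> (lam4 + 1) * (q + (lam5 - 5) * y)"
      "(lam4 + 1) * (q + (lam5 - 5) * y) \<le> (lam4 + 1) * (2 * q)"
      using lam_pos by (intro mult_left_mono; simp)+
    then show ?thesis by (simp add: form5_def)
  qed
qed (use lam_pos form5_step digit_weight_5 in auto)

end

section \<open>Digit sequences made of alternating runs of 5 and 4\<close>

lemma exists_block_lengths:
  assumes \<psi>: "filterlim \<psi> at_top at_top" and D: "0 \<le> D"
  shows "\<exists>n m :: nat. 1 \<le> n \<and> D \<le> \<psi> (real (T + n)) \<and> K \<le> e + (5 - kappa2) * real n \<and>
    - D \<le> e + (5 - kappa2) * real n - (kappa2 - 4) * real m \<and>
    e + (5 - kappa2) * real n - (kappa2 - 4) * real m \<le> - D + 1"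
proof -
  obtain B where B: "\<And>x. B \<le> x \<Longrightarrow> D \<le> \<psi> x"
    using \<psi> by (auto simp: filterlim_at_top eventually_at_top_linorder)
  \<comment> \<open>Enough 5s to pass \<open>B\<close> and to lift the excess to \<open>K\<close>;
    \<open>max 0 K\<close> also keeps \<open>E\<close> nonnegative, so that the floor defining
    \<open>m\<close> is not cut off by \<open>nat\<close>.\<close>
  obtain n where n: "max (max 1 B) ((max 0 K - e) / (5 - kappa2)) < real n" using reals_Archimedean2 by blast
  define E where "E = e + (5 - kappa2) * real n"
  have "(max 0 K - e) / (5 - kappa2) < real n" using n by simp
  then have E: "max 0 K \<le> E" using kappa2_lt_5 by (simp add: E_def field_simps)
  \<comment> \<open>The largest number of 4s that keeps the excess at least \<open>- D\<close>. One
    4 lowers it by \<open>kappa2 - 4\<close>, which is less than 1, whence the final margin.\<close>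
  define m where "m = nat \<lfloor>(E + D) / (kappa2 - 4)\<rfloor>"
  have "0 \<le> (E + D) / (kappa2 - 4)" using E D kappa2_gt_4 by simp
  then have "real m \<le> (E + D) / (kappa2 - 4)" "(E + D) / (kappa2 - 4) < real m + 1"
    unfolding m_def by linarith+
  then have "(kappa2 - 4) * real m \<le> E + D" "E + D \<le> (kappa2 - 4) * real m + (kappa2 - 4)"
    using kappa2_gt_4 by (simp_all add: field_simps)
  moreover have "D \<le> \<psi> (real (T + n))" using n by (intro B) simp
  moreover have "1 \<le> n" using n by simp
  ultimately show ?thesis
    using E kappa2_lt_5 unfolding E_def by (intro exI[of _ n] exI[of _ m]) auto
qed

text \<open>Round \<open>k\<close> starts after index \<open>T k\<close> with excess
  \<open>e k\<close> and consists of \<open>n k\<close> fives, then \<open>m k\<close> fours. Its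
  lengths depend on both values, hence the recursion on pairs. \<open>T 0 = 1\<close> leaves the
  first digit free.\<close>

lemma exists_block_schedule:
  assumes \<psi>: "filterlim \<psi> at_top at_top" and D: "\<And>k::nat. 0 \<le> D k"
  obtains T n m :: "nat \<Rightarrow> nat" and e :: "nat \<Rightarrow> real"
  where "T 0 = 1" "e 0 = e0" "\<And>k. T (Suc k) = T k + n k + m k"
    "\<And>k. e (Suc k) = e k + (5 - kappa2) * real (n k) - (kappa2 - 4) * real (m k)"
    "\<And>k. 1 \<le> n k" "\<And>k. D k \<le> \<psi> (real (T k + n k))"
    "\<And>k. real k \<le> e k + (5 - kappa2) * real (n k)"
    "\<And>k. - D k \<le> e (Suc k)" "\<And>k. e (Suc k) \<le> - D k + 1"
proof -
  define P where "P k T e n m \<longleftrightarrow> 1 \<le> n \<and> D k \<le> \<psi> (real (T + n)) \<and>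
      real k \<le> e + (5 - kappa2) * real n \<and>
      - D k \<le> e + (5 - kappa2) * real n - (kappa2 - 4) * real m \<and>
      e + (5 - kappa2) * real n - (kappa2 - 4) * real m \<le> - D k + 1" for k T n m :: nat and e
  have "\<exists>n m. P k T e n m" for k T e
    unfolding P_def by (rule exists_block_lengths[OF \<psi> D])
  then obtain N M where "\<And>k T e. P k T e (N k T e) (M k T e)" by metis
  note NM = this[unfolded P_def]
  define st where "st = rec_nat (1::nat, e0) (\<lambda>k (T, e).
      (T + N k T e + M k T e, e + (5 - kappa2) * real (N k T e) - (kappa2 - 4) * real (M k T e)))"
  define T where "T k = fst (st k)" for k
  define e where "e k = snd (st k)" for k
  have 0: "T 0 = 1" "e 0 = e0" by (simp_all add: T_def e_def st_def)
  have Suc: "T (Suc k) = T k + N k (T k) (e k) + M k (T k) (e k)"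
    "e (Suc k) = e k + (5 - kappa2) * real (N k (T k) (e k)) - (kappa2 - 4) * real (M k (T k) (e k))" for k
    by (simp_all add: T_def e_def st_def split: prod.split)
  show thesis
    using 0 Suc NM
    by (intro that[of T e "\<lambda>k. N k (T k) (e k)" "\<lambda>k. M k (T k) (e k)"]) simp_all
qed

lemma no_derivative_sequence:
  assumes \<psi>: "mono_on {1..} \<psi>" "filterlim \<psi> at_top at_top"
  obtains a :: "nat \<Rightarrow> nat" and u v :: "nat \<Rightarrow> nat" where "digits a"
    "\<And>t. 1 \<le> t \<Longrightarrow> - \<psi> (real t) \<le> digit_excess a t"
    "filterlim u sequentially sequentially" "(\<lambda>k. slope_scale a (u k)) \<longlonglongrightarrow> 0"
    "filterlim v sequentially sequentially" "filterlim (\<lambda>k. slope_scale a (v k)) at_top sequentially"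
proof -
  \<comment> \<open>The first digit is taken so large that the bound holds at index 1, even if
    \<open>\<psi> 1\<close> is negative.\<close>
  obtain A0 :: nat where A0: "kappa2 - \<psi> 1 \<le> real A0" using real_arch_simple by blast
  define A where "A = max 1 A0"
  have A: "1 \<le> A" "kappa2 - \<psi> 1 \<le> real A" using A0 by (auto simp: A_def)
  \<comment> \<open>A round costs at most a factor 4 in \<open>W\<close>, hence 16 in the slope
    scale. \<open>D k\<close> outweighs k + 1 rounds and leaves a gain of exp k; the summand 1
    absorbs the margin of the schedule.\<close>
  define D :: "nat \<Rightarrow> real" where "D k = 1 + (real (k + 1) * ln 16 + real k) / (2 * growth_gap)" for k
  have D0: "0 \<le> D k" for k using growth_gap_pos by (simp add: D_def)
  obtain T n m e where S: "T 0 = 1" "e 0 = real A - kappa2" "\<And>k. T (Suc k) = T k + n k + m k"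
    "\<And>k. e (Suc k) = e k + (5 - kappa2) * real (n k) - (kappa2 - 4) * real (m k)"
    "\<And>k. 1 \<le> n k" "\<And>k. D k \<le> \<psi> (real (T k + n k))"
    "\<And>k. real k \<le> e k + (5 - kappa2) * real (n k)"
    "\<And>k. - D k \<le> e (Suc k)" "\<And>k. e (Suc k) \<le> - D k + 1"
    by (rule exists_block_schedule[of \<psi> D, OF \<psi>(2) D0, of "real A - kappa2"]) (rule that)
  define a where "a t = (if t \<le> 1 then A else if \<exists>k. T k < t \<and> t \<le> T k + n k then 5 else 4)" for t
  interpret digits a by unfold_locales (use A in \<open>auto simp: a_def\<close>)
  have T_mono: "T j \<le> T k" if "j \<le> k" for j k
    by (rule lift_Suc_mono_le[OF _ that]) (simp add: S)
  have T_ge: "k + 1 \<le> T k" for k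
    by (induction k) (use S(1,3,5) in \<open>auto simp: Suc_le_eq intro: le_less_trans\<close>)
  have T_ge_1: "1 \<le> T k" for k using T_ge[of k] by simp
  have five: "a i = 5" if "T k < i" "i \<le> T k + n k" for i k
    using that T_ge_1[of k] by (auto simp: a_def)
  have four: "a i = 4" if i: "T k + n k < i" "i \<le> T k + n k + m k" for i k
  proof -
    have "\<not> (T j < i \<and> i \<le> T j + n j)" for j
    proof -
      consider "j < k" | "j = k" | "k < j" by linarith
      then show ?thesis
      proof cases
        case 1
        then have "T j + n j \<le> T k" using T_mono[of "Suc j" k] S(3)[of j] by simp
        then show ?thesis using i by simp
      next
        case 3
        then have "i \<le> T j" using T_mono[of "Suc k" j] S(3)[of k] i by simp
        then show ?thesis by simp
      qed (use i in simp)
    qed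
    then show ?thesis using i T_ge_1[of k] by (auto simp: a_def)
  qed
  have ex5: "digit_excess a (T k + i) = digit_excess a (T k) + (5 - kappa2) * real i" if "i \<le> n k" for k i
    using digit_excess_constant[of "T k" i a 5] five that by simp
  have ex4: "digit_excess a (T k + n k + i) = digit_excess a (T k + n k) - (kappa2 - 4) * real i" if "i \<le> m k" for k i
    using digit_excess_constant[of "T k + n k" i a 4] four[of k] that by (simp add: algebra_simps)
  have exT: "digit_excess a (T k) = e k" for k
  proof (induction k)
    case 0
    then show ?case using S(1,2) by (simp add: a_def)
  next
    case (Suc k)
    then show ?case using ex5[of "n k" k] ex4[of "m k" k] S(3,4)[of k] by simp
  qed
  have \<psi>_mono: "\<psi> (real s) \<le> \<psi> (real t)" if "1 \<le> s" "s \<le> t" for s t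
    using that by (intro mono_onD[OF \<psi>(1)]) auto
  have e_ge: "- \<psi> (real (T k)) \<le> e k" for k
  proof (cases k)
    case 0
    then show ?thesis using S(1,2) A by simp
  next
    case (Suc j)
    then show ?thesis
      using S(3,6,8)[of j] \<psi>_mono[of "T j + n j" "T k"] T_ge_1[of j] by simp
  qed
  have bound: "- \<psi> (real t) \<le> digit_excess a t" if t: "1 \<le> t" for t
  proof -
    \<comment> \<open>Locates the round \<open>j = k - 1\<close> containing \<open>t\<close>;
      \<open>k = 0\<close> is the first digit.\<close>
    define k where "k = (LEAST k. t \<le> T k)"
    have k: "t \<le> T k" unfolding k_def by (rule LeastI[of _ t]) (use T_ge[of t] in simp)
    show ?thesis
    proof (cases k)
      case 0
      then have "t = T 0" using k t S(1) by simp
      then show ?thesis using exT[of 0] e_ge[of 0] by simp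
    next
      case (Suc j)
      then have j: "T j < t" using not_less_Least[of j "\<lambda>k. t \<le> T k"] by (simp add: k_def not_le)
      show ?thesis
      \<comment> \<open>The excess rises along the 5s from \<open>e j\<close> and then falls along
        the 4s to \<open>e (Suc j)\<close>; by the time it falls, \<open>\<psi>\<close> has reached
        \<open>D j\<close>.\<close>
      proof (cases "t \<le> T j + n j")
        case True
        have "digit_excess a t = e j + (5 - kappa2) * real (t - T j)"
          using ex5[of "t - T j" j] exT[of j] True j by simp
        moreover have "0 \<le> (5 - kappa2) * real (t - T j)" using kappa2_lt_5 by simp
        ultimately show ?thesis using e_ge[of j] \<psi>_mono[of "T j" t] T_ge_1[of j] j by simp
      next
        case False
        define i where "i = t - (T j + n j)"
        have i: "i \<le> m j" "t = T j + n j + i" using False k Suc S(3)[of j] by (auto simp: i_def)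
        have "(kappa2 - 4) * real i \<le> (kappa2 - 4) * real (m j)"
          using i kappa2_gt_4 by (intro mult_left_mono) auto
        then have "e (Suc j) \<le> digit_excess a t"
          unfolding i(2) ex4[OF i(1)] using ex5[of "n j" j] exT[of j] S(4)[of j] by simp
        then show ?thesis using S(6,8)[of j] \<psi>_mono[of "T j + n j" t] T_ge_1[of j] i(2) by simp
      qed
    qed
  qed
  define W where "W t = cf_den a t / weight_product t" for t
  define c where "c = W 1"
  have c: "0 < c" using cf_den_pos[of 1] weight_product_pos[of 1] by (simp add: c_def W_def)
  have den: "c / 4 ^ k \<le> W (T k)" for k
  proof (induction k)
    case 0
    then show ?case by (simp add: S(1) c_def)
  next
    case (Suc k)
    have "W (T k) \<le> 2 * W (T k + n k)"
      unfolding W_def by (rule cf_den_block_5) (rule five)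
    also have "W (T k + n k) \<le> 2 * W (T (Suc k))"
      unfolding S(3) W_def by (rule cf_den_block_4) (rule four)
    finally have "c / 4 ^ k \<le> 4 * W (T (Suc k))" using Suc by simp
    then show ?case by (simp add: field_simps)
  qed
  have small: "slope_scale a (T k + n k) \<le> (rel_potential 0)\<^sup>2 * exp (- (2 * growth_gap * real k))" for k
  proof -
    have "real k \<le> digit_excess a (T k + n k)" using ex5[of "n k" k] exT[of k] S(7)[of k] by simp
    then have "2 * growth_gap * real k \<le> 2 * growth_gap * digit_excess a (T k + n k)"
      using growth_gap_pos by simp
    moreover have "(rel_potential (T k + n k))\<^sup>2 \<le> (rel_potential 0)\<^sup>2"
      using decseqD[OF rel_potential_decseq, of 0 "T k + n k"] rel_potential_pos[of "T k + n k"]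
      by (intro power_mono) auto
    ultimately show ?thesis
      using slope_scale_le[of "T k + n k"] by (elim order_trans) (auto intro!: mult_mono)
  qed
  have large: "c\<^sup>2 * exp (real k) \<le> slope_scale a (T (Suc k))" for k
  proof -
    have "c\<^sup>2 * exp (real k) = (c / 4 ^ Suc k)\<^sup>2 * (16 ^ Suc k * exp (real k))"
      by (simp add: power_divide power_mult[symmetric] mult.commute[of k 2]) (simp add: power_mult)
    also have "16 ^ Suc k * exp (real k) = exp (2 * growth_gap * (D k - 1))"
      using growth_gap_pos exp_of_nat_mult[of "Suc k" "ln (16::real)"]
      by (simp add: D_def exp_add add.commute)
    also have "(c / 4 ^ Suc k)\<^sup>2 * \<dots> \<le> slope_scale a (T (Suc k))"
      unfolding slope_scale_eq W_def[symmetric]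
    proof (intro mult_mono power_mono)
      have "2 * growth_gap * (D k - 1) \<le> 2 * growth_gap * - e (Suc k)"
        using growth_gap_pos S(9)[of k] by (intro mult_left_mono) auto
      then show "exp (2 * growth_gap * (D k - 1)) \<le> exp (- (2 * growth_gap * digit_excess a (T (Suc k))))"
        by (simp add: exT)
    qed (use den[of "Suc k"] c in auto)
    finally show ?thesis .
  qed
  show thesis
  \<comment> \<open>The slope scale is small at the ends of the runs of 5 and large at the ends of
    the runs of 4.\<close>
  proof (rule that[of a "\<lambda>k. T k + n k" "\<lambda>k. T (Suc k)"])
    have "k \<le> T k + n k" "k \<le> T (Suc k)" for k using T_ge[of k] T_ge[of "Suc k"] by simp_all
    then show "filterlim (\<lambda>k. T k + n k) sequentially sequentially"
      "filterlim (\<lambda>k. T (Suc k)) sequentially sequentially"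
      by (auto intro: filterlim_at_top_mono[OF filterlim_ident] always_eventually)
    have "(\<lambda>k::nat. B * exp (- (2 * g * real k))) \<longlonglongrightarrow> 0" if "0 < g" for B g :: real
      using that by real_asymp
    from this[OF growth_gap_pos] show "(\<lambda>k. slope_scale a (T k + n k)) \<longlonglongrightarrow> 0"
      by (rule tendsto_sandwich[OF always_eventually[OF allI[OF slope_scale_nonneg]]
            always_eventually[OF allI[OF small]] tendsto_const])
    have "filterlim (\<lambda>k::nat. B * exp (real k)) at_top sequentially" if "0 < B" for B :: real
      using that by real_asymp
    from this[of "c\<^sup>2"] show "filterlim (\<lambda>k. slope_scale a (T (Suc k))) at_top sequentially"
      using c by (intro filterlim_at_top_mono[OF _ always_eventually[OF allI[OF large]]]) simp
  qed (use bound digits_axioms in auto)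
qed

theorem theorem3:
  shows
    "(\<forall>x::real. 0 < x \<and> x < 1 \<and> x \<notin> \<rat> \<and>
        (\<exists>C::real. \<forall>t::nat. t \<ge> 1 \<longrightarrow> real (pq_sum x t) \<ge> kappa2 * real t - C) \<longrightarrow>
        has_ext_derivative question_mark 0 x)
     \<and>
     (\<forall>\<psi>::real \<Rightarrow> real. mono_on {1..} \<psi> \<and> filterlim \<psi> at_top at_top \<longrightarrow>
        (\<exists>x::real. 0 < x \<and> x < 1 \<and> x \<notin> \<rat> \<and>
           \<not> ext_derivative_exists question_mark x \<and>
           (\<forall>t::nat. t \<ge> 1 \<longrightarrow> real (pq_sum x t) \<ge> kappa2 * real t - \<psi> (real t))))"
proof (intro conjI allI impI)
  fix x :: real
  assume "0 < x \<and> x < 1 \<and> x \<notin> \<rat> \<and>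
    (\<exists>C::real. \<forall>t::nat. t \<ge> 1 \<longrightarrow> real (pq_sum x t) \<ge> kappa2 * real t - C)"
  then show "has_ext_derivative question_mark 0 x"
    using question_mark_derivative_0[of x] by blast
next
  fix \<psi> :: "real \<Rightarrow> real"
  assume \<psi>: "mono_on {1..} \<psi> \<and> filterlim \<psi> at_top at_top"
  obtain a u v where a: "digits a" "\<And>t. 1 \<le> t \<Longrightarrow> - \<psi> (real t) \<le> digit_excess a t"
    "filterlim u sequentially sequentially" "(\<lambda>k. slope_scale a (u k)) \<longlonglongrightarrow> 0"
    "filterlim v sequentially sequentially" "filterlim (\<lambda>k. slope_scale a (v k)) at_top sequentially"
    by (rule no_derivative_sequence[OF conjunct1[OF \<psi>] conjunct2[OF \<psi>]]) (rule that)
  interpret digits a by (rule a)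
  obtain x r where x: "0 < x" "x < 1" "x \<notin> \<rat>" "\<And>t. x = cf_app a t (r t)" "\<And>t. 0 < r t \<and> r t < 1"
    "\<And>t. pq_sum x t = digit_sum a t"
    by (rule exists_real_with_digits) (rule that)
  have "\<not> ext_derivative_exists question_mark x"
    using x(4,5) a(3-6) by (rule not_ext_derivative_exists)
  moreover have "kappa2 * real t - \<psi> (real t) \<le> real (pq_sum x t)" if "1 \<le> t" for t
    using a(2)[OF that] by (simp add: x(6) digit_excess_def)
  ultimately show "\<exists>x::real. 0 < x \<and> x < 1 \<and> x \<notin> \<rat> \<and>
      \<not> ext_derivative_exists question_mark x \<and>
      (\<forall>t::nat. t \<ge> 1 \<longrightarrow> real (pq_sum x t) \<ge> kappa2 * real t - \<psi> (real t))"
    using x(1-3) by blast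
qed

end
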